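(* Suppose $\Omega$ is an aperiodic subshift that satisfies the Boshernitzan condition (B). Then the set of uniform cocycles is a dense $G_\delta$-set in $C(\Omega,\mathrm{SL}(2,\mathbb{R}))$.
   Context: Let $\mathcal{A}$ be a finite set with the discrete topology and give $\mathcal{A}^{\mathbb{Z}}$ the product topology. A subshift is a closed shift-invariant subset $\Omega\subseteq\mathcal{A}^{\mathbb{Z}}$, with $T:\Omega\to\Omega$ the shift $(T\omega)_n=\omega_{n+1}$, which is a homeomorphism. For $n\in\mathbb{N}$ let $\Omega_n=\{\omega_1\cdots\omega_n:\omega\in\Omega\}$, and for $w\in\Omega_n$ let $[w]=\{\omega\in\Omega:\omega_1\cdots\omega_n=w\}$. $\Omega$ satisfies the Boshernitzan condition (B) if it is minimal and there is a $T$-invariant Borel probability measure $\mu$ with $\limsup_{n\to\infty} n\cdot\min\{\mu([w]):w\in\Omega_n\}>0$. $\Omega$ is aperiodic if it contains no periodic element, i.e. no $\omega$ with $T^p\omega=\omega$ for some $p\ge1$. $C(\Omega,\mathrm{SL}(2,\mathbb{R}))$ is the set of continuous maps (cocycles) $A:\Omega\to\mathrm{SL}(2,\mathbb{R})$ with the topology of uniform convergence. For $n\ge1$, $A_n(\omega)=A(T^{n-1}\omega)\cdots A(T\omega)A(\omega)$. A cocycle $A$ is uniform if there is a number $L(A)$ such that $\lim_{n\to\infty}\frac1n\log\|A_n(\omega)\|=L(A)$ uniformly in $\omega\in\Omega$. *)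

theory Defs
  imports "HOL-Analysis.Analysis" "HOL-Probability.Probability"
begin

text \<open>
  The alphabet is a finite type \<open>'a\<close> with the discrete topology; the space \<open>int \<Rightarrow> 'a\<close> of
  two-sided sequences then carries the library's product topology.
\<close>

definition shift :: "(int \<Rightarrow> 'a) \<Rightarrow> (int \<Rightarrow> 'a)" where
  "shift \<omega> = (\<lambda>n. \<omega> (n + 1))"

text \<open>Invariance is \<open>shift ` \<Omega> = \<Omega>\<close>, so that the shift restricts to a homeomorphism of \<open>\<Omega>\<close>.\<close>

definition subshift :: "(int \<Rightarrow> 'a::{finite, discrete_topology}) set \<Rightarrow> bool" where
  "subshift \<Omega> \<longleftrightarrow> closed \<Omega> \<and> shift ` \<Omega> = \<Omega>"

definition aperiodic :: "(int \<Rightarrow> 'a) set \<Rightarrow> bool" where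
  "aperiodic \<Omega> \<longleftrightarrow> \<not> (\<exists>\<omega>\<in>\<Omega>. \<exists>p\<ge>1. (shift ^^ p) \<omega> = \<omega>)"

definition orbit :: "(int \<Rightarrow> 'a) \<Rightarrow> (int \<Rightarrow> 'a) set" where
  "orbit \<omega> = range (\<lambda>k::int. \<lambda>n. \<omega> (n + k))"

definition minimal_subshift :: "(int \<Rightarrow> 'a::{finite, discrete_topology}) set \<Rightarrow> bool" where
  "minimal_subshift \<Omega> \<longleftrightarrow> subshift \<Omega> \<and> (\<forall>\<omega>\<in>\<Omega>. \<Omega> \<subseteq> closure (orbit \<omega>))"

definition prefix_word :: "nat \<Rightarrow> (int \<Rightarrow> 'a) \<Rightarrow> 'a list" where
  "prefix_word n \<omega> = map \<omega> [1..int n]"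

definition words :: "(int \<Rightarrow> 'a) set \<Rightarrow> nat \<Rightarrow> 'a list set" where
  "words \<Omega> n = prefix_word n ` \<Omega>"

definition cylinder :: "(int \<Rightarrow> 'a) set \<Rightarrow> 'a list \<Rightarrow> (int \<Rightarrow> 'a) set" where
  "cylinder \<Omega> w = {\<omega>\<in>\<Omega>. prefix_word (length w) \<omega> = w}"

definition invariant_prob ::
    "(int \<Rightarrow> 'a::{finite, discrete_topology}) set \<Rightarrow> (int \<Rightarrow> 'a) measure \<Rightarrow> bool" where
  "invariant_prob \<Omega> \<mu> \<longleftrightarrow>
     prob_space \<mu> \<and> sets \<mu> = sets (restrict_space borel \<Omega>) \<and>
     (\<forall>B\<in>sets \<mu>. emeasure \<mu> (shift -` B \<inter> \<Omega>) = emeasure \<mu> B)"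

text \<open>The limit superior is taken in the extended reals, so that it always exists.\<close>

definition boshernitzan :: "(int \<Rightarrow> 'a::{finite, discrete_topology}) set \<Rightarrow> bool" where
  "boshernitzan \<Omega> \<longleftrightarrow> minimal_subshift \<Omega> \<and>
     (\<exists>\<mu>. invariant_prob \<Omega> \<mu> \<and>
        limsup (\<lambda>n. ereal (real n * Min ((\<lambda>w. measure \<mu> (cylinder \<Omega> w)) ` words \<Omega> n))) > 0)"

definition SL2 :: "(real^2^2) set" where
  "SL2 = {M. det M = 1}"

text \<open>
  Continuous maps \<open>\<Omega> \<rightarrow> SL(2,\<real>)\<close> with the supremum metric. As always for the library's function
  spaces, the points are functions on the ambient type that are \<open>undefined\<close> outside \<open>\<Omega>\<close>; the
  boundedness built into \<open>cfunspace\<close> is automatic since a subshift is compact.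
\<close>

definition cocycle_metric ::
    "(int \<Rightarrow> 'a::{finite, discrete_topology}) set \<Rightarrow> ((int \<Rightarrow> 'a) \<Rightarrow> real^2^2) metric" where
  "cocycle_metric \<Omega> = cfunspace (top_of_set \<Omega>) (submetric euclidean_metric SL2)"

definition cocycles ::
    "(int \<Rightarrow> 'a::{finite, discrete_topology}) set \<Rightarrow> ((int \<Rightarrow> 'a) \<Rightarrow> real^2^2) set" where
  "cocycles \<Omega> = mspace (cocycle_metric \<Omega>)"

definition cocycle_topology ::
    "(int \<Rightarrow> 'a::{finite, discrete_topology}) set \<Rightarrow> ((int \<Rightarrow> 'a) \<Rightarrow> real^2^2) topology" where
  "cocycle_topology \<Omega> = mtopology_of (cocycle_metric \<Omega>)"

primrec cocycle_iter ::
    "((int \<Rightarrow> 'a) \<Rightarrow> real^2^2) \<Rightarrow> nat \<Rightarrow> (int \<Rightarrow> 'a) \<Rightarrow> real^2^2" where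
  "cocycle_iter A 0 \<omega> = mat 1"
| "cocycle_iter A (Suc n) \<omega> = A ((shift ^^ n) \<omega>) ** cocycle_iter A n \<omega>"

text \<open>The matrix norm is the operator norm for the Euclidean norm on the plane.\<close>

definition uniform_cocycle :: "(int \<Rightarrow> 'a) set \<Rightarrow> ((int \<Rightarrow> 'a) \<Rightarrow> real^2^2) \<Rightarrow> bool" where
  "uniform_cocycle \<Omega> A \<longleftrightarrow>
     (\<exists>L::real. uniform_limit \<Omega> (\<lambda>n \<omega>. 1 / real n * ln (onorm ((*v) (cocycle_iter A n \<omega>))))
                  (\<lambda>_. L) sequentially)"

end

theory Submission imports Defs begin

text \<open>
A cocycle \<open>A\<close> has the products \<open>A\<^sub>n\<close>, and \<open>growth A n\<close> is the function \<open>ln \<parallel>A\<^sub>n\<parallel>\<close>. The proof reduces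
uniformity to conditions on two consecutive scales \<open>m\<close> and \<open>2m\<close>, and then checks these conditions
for locally constant cocycles by counting words.

\<^bold>\<open>Uniformity is a condition at finite scales.\<close> Suppose that, everywhere on \<open>\<Omega>\<close>, the growth over \<open>m\<close>
steps is at most \<open>m (l + e)\<close> and the growth over \<open>2m\<close> steps is at least \<open>2m (l - e)\<close>, and that
\<open>m e \<ge> 1\<close> (\<open>rigid_at\<close>). Then two consecutive blocks of length \<open>m\<close> never cancel much, and in
dimension two this is inherited by arbitrarily many consecutive blocks: for \<open>det B = 1\<close>,
\<open>\<parallel>AB\<parallel> \<parallel>BC\<parallel> \<le> \<parallel>B\<parallel> \<parallel>ABC\<parallel> + 6 \<parallel>A\<parallel> \<parallel>C\<parallel>\<close> (\<open>avalanche_ineq\<close>), a soft form of the avalanche principle. So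
\<open>growth A n / n\<close> stays within a multiple of \<open>e\<close> of \<open>l\<close> for all large \<open>n\<close>, and a cocycle is uniform
iff it is rigid for every \<open>e > 0\<close> at some scale (\<open>uniform_cocycle_iff_rigid\<close>). Rigidity at a fixed
scale is stable under small perturbations of the cocycle, and this makes the set of uniform
cocycles a \<open>G\<^sub>\<delta>\<close> set. As locally constant cocycles are dense, it remains to see that these are
uniform (\<open>locally_constant_imp_rigid\<close>).

\<^bold>\<open>The rates are almost invariant in mean square.\<close> Let \<open>f = growth A m / m\<close>. By subadditivity and
convexity, the integral of \<open>f\<^sup>2\<close> is almost minimal among all scales when \<open>m\<close> is a multiple of a
suitable number. The parallelogram law then makes \<open>f \<circ> T\<^sup>i - f\<close> small in mean square, for all \<open>i\<close>
simultaneously (\<open>ex_almost_invariant_scale\<close>).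

\<^bold>\<open>Words make smallness in mean square uniform.\<close> For a locally constant cocycle, \<open>f\<close> depends on a word
of length comparable to \<open>m\<close>. The condition (B) supplies lengths \<open>N\<close> at which every word has measure
at least \<open>c/N\<close>, so that any set that is seen by words of length \<open>N\<close>, and that contains a fixed
fraction of \<open>N\<close> different words, has measure bounded below. This is used twice, with \<open>m\<close>
comparable to \<open>N\<close>.

\<^item> \<open>small_drift\<close>: along an orbit \<open>f\<close> changes by at most a constant over \<open>m\<close> at each step. If \<open>f\<close>
  changed by \<open>\<delta>\<close> within about \<open>m\<close> steps, it would pass through a number proportional to \<open>m\<close> of
  different values, hence of different words, near the first level and near the last one; this
  contradicts the mean square estimate.

\<^item> \<open>small_oscillation\<close>: let \<open>f\<close> climb, by small drift slowly, through a band of width \<open>3\<delta>\<close>. While it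
  does so the orbit shows about \<open>m/3\<close> different words inside that band
  (\<open>many_words_between_levels\<close>): otherwise a word recurs after a short time \<open>p\<close>, the orbit is periodic
  with period \<open>p\<close> for a while, this stretch must end before \<open>f\<close> leaves the band, and the words that
  the orbit shows around the first violation of the period are all different. So each band has measure bounded below
  independently of \<open>\<delta>\<close>, there are boundedly many bands, and by minimality some orbit connects the
  minimum and the maximum of \<open>f\<close> and passes through all of them. Hence the oscillation of \<open>f\<close> is small.

So the rates at scales \<open>m\<close> and \<open>2m\<close> are nearly constant, and both constants are close to the square
root of the minimal mean square. That is rigidity.
\<close>

section \<open>Real two-by-two matrices of determinant one\<close>

definition opnorm :: "real^2^2 \<Rightarrow> real" where
  "opnorm M = onorm ((*v) M)"

text \<open>
The determinant of the matrix with columns \<open>x\<close> and \<open>y\<close>. Its invariance under matrices of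
determinant one expresses that expansion in one direction is balanced by contraction in another.
\<close>

definition cross2 :: "real^2 \<Rightarrow> real^2 \<Rightarrow> real" where
  "cross2 x y = x $ 1 * y $ 2 - x $ 2 * y $ 1"

definition perp :: "real^2 \<Rightarrow> real^2" where
  "perp x = vector [- x $ 2, x $ 1]"

lemma opnorm_nonneg: "0 \<le> opnorm M"
  by (simp add: opnorm_def onorm_pos_le)

lemma norm_mult_vec_le_opnorm: "norm (M *v x) \<le> opnorm M * norm x"
  by (simp add: opnorm_def onorm)

lemma opnorm_leI: "(\<And>x. norm (M *v x) \<le> b * norm x) \<Longrightarrow> opnorm M \<le> b"
  by (simp add: opnorm_def onorm_le)

lemma opnorm_mult_le: "opnorm (M ** M') \<le> opnorm M * opnorm M'"
  using onorm_compose[of "(*v) M" "(*v) M'"]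
  by (simp add: opnorm_def o_def matrix_vector_mul_assoc)

lemma opnorm_le_norm: "opnorm M \<le> norm M"
proof (rule opnorm_leI)
  fix x :: "real^2"
  have "norm (M *v x) = L2_set (\<lambda>i. norm (inner (M $ i) x)) UNIV"
    by (simp add: norm_vec_def matrix_mult_dot)
  also have "\<dots> \<le> L2_set (\<lambda>i. norm (M $ i) * norm x) UNIV"
    by (intro L2_set_mono) (auto simp: Cauchy_Schwarz_ineq2)
  also have "\<dots> = norm M * norm x"
    by (simp add: L2_set_left_distrib norm_vec_def)
  finally show "norm (M *v x) \<le> norm M * norm x" .
qed

lemma opnorm_diff_le: "\<bar>opnorm M - opnorm M'\<bar> \<le> opnorm (M - M')"
proof -
  have tri: "opnorm M \<le> opnorm (M - M') + opnorm M'" for M M' :: "real^2^2"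
  proof (rule opnorm_leI)
    fix x
    have "M *v x = (M - M') *v x + M' *v x"
      by (simp add: matrix_vector_mult_diff_rdistrib)
    then have "norm (M *v x) \<le> norm ((M - M') *v x) + norm (M' *v x)"
      by (metis norm_triangle_ineq)
    also have "\<dots> \<le> opnorm (M - M') * norm x + opnorm M' * norm x"
      by (intro add_mono norm_mult_vec_le_opnorm)
    finally show "norm (M *v x) \<le> (opnorm (M - M') + opnorm M') * norm x"
      by (simp add: algebra_simps)
  qed
  have sym: "opnorm (M' - M) = opnorm (M - M')"
  proof -
    have "(*v) (M' - M) = (\<lambda>x. - ((M - M') *v x))"
      by (auto simp: matrix_vector_mult_diff_rdistrib)
    then show ?thesis unfolding opnorm_def by (simp add: onorm_neg)
  qed
  show ?thesis using tri[of M M'] tri[of M' M] sym by linarith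
qed

lemma norm2_sq: "(norm (x::real^2))\<^sup>2 = (x $ 1)\<^sup>2 + (x $ 2)\<^sup>2"
  unfolding power2_norm_eq_inner by (simp add: inner_vec_def sum_2 power2_eq_square)

lemma cross2_le_norm: "\<bar>cross2 x y\<bar> \<le> norm x * norm y"
proof -
  have "(cross2 x y)\<^sup>2 + (inner x y)\<^sup>2 = (norm x * norm y)\<^sup>2"
    unfolding power_mult_distrib norm2_sq cross2_def
    by (simp add: inner_vec_def sum_2 power2_eq_square algebra_simps)
  then have "(cross2 x y)\<^sup>2 \<le> (norm x * norm y)\<^sup>2"
    by (metis le_add_same_cancel1 zero_le_power2)
  then show ?thesis
    by (simp add: abs_le_square_iff[symmetric] abs_mult)
qed

lemma cross2_mult_vec: "cross2 (M *v x) (M *v y) = det M * cross2 x y"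
  by (simp add: cross2_def det_2 matrix_vector_mult_def sum_2 algebra_simps)

lemma cross2_perp: "cross2 x (perp x) = (norm x)\<^sup>2"
  unfolding norm2_sq by (simp add: cross2_def perp_def power2_eq_square)

lemma norm_perp [simp]: "norm (perp x) = norm x"
proof -
  have "(norm (perp x))\<^sup>2 = (norm x)\<^sup>2" unfolding norm2_sq by (simp add: perp_def)
  then show ?thesis by simp
qed

text \<open>
A unit vector \<open>t\<close> and its rotation by a right angle form an orthonormal basis.
\<close>

lemma perp_expand:
  assumes "norm t = 1"
  shows "c = inner c (perp t) *\<^sub>R perp t + inner c t *\<^sub>R t"
proof -
  have 1: "(t $ 1)\<^sup>2 + (t $ 2)\<^sup>2 = 1" using assms norm2_sq[of t] by simp
  have "c $ 1 = (c $ 1 * (- t $ 2) + c $ 2 * t $ 1) * (- t $ 2) + (c $ 1 * t $ 1 + c $ 2 * t $ 2) * t $ 1"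
       "c $ 2 = (c $ 1 * (- t $ 2) + c $ 2 * t $ 1) * t $ 1 + (c $ 1 * t $ 1 + c $ 2 * t $ 2) * t $ 2"
    using 1 by algebra+
  then show ?thesis
    by (simp add: vec_eq_iff forall_2 perp_def inner_vec_def sum_2)
qed

text \<open>
A matrix that preserves areas cannot contract any direction by more than it expands another one.
So \<open>opnorm M\<close> also bounds the inverse of \<open>M\<close>.
\<close>

lemma norm_le_opnorm_mult_norm:
  assumes "det M = 1"
  shows "norm x \<le> opnorm M * norm (M *v x)"
proof (cases "x = 0")
  case False
  have "norm x * norm x = cross2 (M *v x) (M *v perp x)"
    by (simp add: cross2_mult_vec assms cross2_perp power2_eq_square)
  also have "\<dots> \<le> norm (M *v x) * norm (M *v perp x)"
    using cross2_le_norm[of "M *v x" "M *v perp x"] by linarith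
  also have "\<dots> \<le> norm (M *v x) * (opnorm M * norm x)"
    using norm_mult_vec_le_opnorm[of M "perp x"] by (intro mult_left_mono) auto
  finally have "norm x * norm x \<le> (opnorm M * norm (M *v x)) * norm x" by (simp add: mult_ac)
  then show ?thesis using False by simp
qed simp

lemma opnorm_ge_1:
  assumes "det M = 1"
  shows "1 \<le> opnorm M"
proof -
  define x :: "real^2" where "x = axis 1 1"
  have x: "norm x = 1" by (simp add: x_def)
  have "norm x \<le> opnorm M * norm (M *v x)" by (rule norm_le_opnorm_mult_norm[OF assms])
  also have "\<dots> \<le> opnorm M * (opnorm M * norm x)"
    by (intro mult_left_mono norm_mult_vec_le_opnorm opnorm_nonneg)
  finally have "1 \<le> (opnorm M)\<^sup>2" by (simp add: x power2_eq_square)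
  then show ?thesis using opnorm_nonneg[of M] power2_le_imp_le[of 1 "opnorm M"] by simp
qed

lemma opnorm_cancel_left:
  assumes "det M = 1"
  shows "opnorm C \<le> opnorm M * opnorm (M ** C)"
proof (rule opnorm_leI)
  fix x
  have "norm (C *v x) \<le> opnorm M * norm ((M ** C) *v x)"
    using norm_le_opnorm_mult_norm[OF assms, of "C *v x"] by (simp add: matrix_vector_mul_assoc)
  also have "\<dots> \<le> opnorm M * (opnorm (M ** C) * norm x)"
    by (intro mult_left_mono norm_mult_vec_le_opnorm opnorm_nonneg)
  finally show "norm (C *v x) \<le> opnorm M * opnorm (M ** C) * norm x" by (simp add: mult.assoc)
qed

lemma det_1_surj:
  fixes M :: "real^2^2"
  assumes "det M = 1"
  obtains u where "M *v u = v"
proof -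
  have "invertible M" using assms by (simp add: invertible_det_nz)
  then obtain M' where "M ** M' = mat 1" unfolding invertible_def by blast
  then have "M *v (M' *v v) = v" by (simp add: matrix_vector_mul_assoc)
  then show ?thesis by (rule that)
qed

lemma opnorm_cancel_right:
  assumes "det M = 1"
  shows "opnorm C \<le> opnorm (C ** M) * opnorm M"
proof (rule opnorm_leI)
  fix x
  obtain u where u: "x = M *v u" using det_1_surj[OF assms, of x] by metis
  have "norm (C *v x) \<le> opnorm (C ** M) * norm u"
    using norm_mult_vec_le_opnorm[of "C ** M" u] by (simp add: u matrix_vector_mul_assoc)
  also have "\<dots> \<le> opnorm (C ** M) * (opnorm M * norm x)"
    using norm_le_opnorm_mult_norm[OF assms, of u] by (intro mult_left_mono opnorm_nonneg) (simp add: u)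
  finally show "norm (C *v x) \<le> opnorm (C ** M) * opnorm M * norm x" by (simp add: mult.assoc)
qed

text \<open>
The direction that is contracted most, up to the factor 2. It is the preimage of the normal to the
image of an almost maximally expanded vector.
\<close>

lemma contracted_direction:
  assumes "det B = 1"
  obtains t where "norm t = 1" "norm (B *v t) * opnorm B \<le> 2"
proof -
  have pos: "0 < opnorm B" using opnorm_ge_1[OF assms] by simp
  have "\<exists>x. opnorm B / 2 * norm x < norm (B *v x)"
  proof (rule ccontr)
    assume "\<not> ?thesis"
    then have "opnorm B \<le> opnorm B / 2" by (intro opnorm_leI) (auto simp: not_less)
    with pos show False by simp
  qed
  then obtain x where x: "opnorm B / 2 * norm x < norm (B *v x)" by blast
  define y where "y = B *v x"
  have "0 \<le> opnorm B / 2 * norm x" using pos by simp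
  then have y0: "norm y > 0" using x unfolding y_def by linarith
  obtain v where v: "B *v v = perp y" using det_1_surj[OF assms, of "perp y"] by metis
  have "(norm y)\<^sup>2 = cross2 x v"
    using cross2_mult_vec[of B x v] by (simp add: assms v cross2_perp flip: y_def)
  also have "\<dots> \<le> norm x * norm v" using cross2_le_norm[of x v] by linarith
  finally have yy: "(norm y)\<^sup>2 \<le> norm x * norm v" .
  have "opnorm B / 2 * (norm y)\<^sup>2 \<le> opnorm B / 2 * norm x * norm v"
    using yy pos by (simp add: mult.assoc mult_left_mono)
  also have "\<dots> \<le> norm y * norm v" using x by (intro mult_right_mono) (auto simp: y_def)
  finally have "opnorm B / 2 * norm y \<le> norm v" using y0 by (simp add: power2_eq_square field_simps)
  moreover have v0: "norm v > 0" using v y0 by (metis less_irrefl matrix_vector_mult_0_right norm_perp zero_less_norm_iff)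
  ultimately have "norm y * opnorm B / norm v \<le> 2" by (simp add: field_simps)
  moreover have "B *v (v /\<^sub>R norm v) = perp y /\<^sub>R norm v"
    by (simp add: matrix_vector_mult_scaleR v)
  ultimately show ?thesis
    using v0 by (intro that[of "v /\<^sub>R norm v"]) (auto simp: divide_inverse mult_ac)
qed

text \<open>
In the basis of a contracted unit vector \<open>t\<close> and its normal \<open>s\<close>, the matrix \<open>B\<close> is almost of rank one: it
acts as \<open>c \<mapsto> \<langle>c, s\<rangle> B s\<close>, up to an error of relative size \<open>1 / \<parallel>B\<parallel>\<^sup>2\<close>. For matrices of rank one the
inequality is the equation \<open>\<parallel>AB\<parallel> |B c| = \<parallel>B\<parallel> |A B c|\<close>; the last summand collects the errors.
\<close>

lemma avalanche_vec:
  assumes "det B = 1"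
  shows "opnorm (A ** B) * norm (B *v c) \<le> opnorm B * norm ((A ** B) *v c) + 6 * opnorm A * norm c"
proof -
  obtain t where t: "norm t = 1" and Bt: "norm (B *v t) * opnorm B \<le> 2"
    by (rule contracted_direction[OF assms])
  define s where "s = perp t"
  define \<alpha> \<beta> where "\<alpha> = inner c s" and "\<beta> = inner c t"
  have s: "norm s = 1" by (simp add: s_def t)
  have pos: "0 < opnorm B" using opnorm_ge_1[OF assms] by simp
  define d where "d = 2 / opnorm B"
  have d0: "d \<ge> 0" using pos by (simp add: d_def)
  have dB: "opnorm B * d = 2" using pos by (simp add: d_def)
  have Bt': "norm (B *v t) \<le> d" using Bt pos by (simp add: d_def field_simps)
  have A0: "0 \<le> opnorm A" by (rule opnorm_nonneg)
  have ABt: "norm ((A ** B) *v t) \<le> opnorm A * d"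
  proof -
    have "norm ((A ** B) *v t) \<le> opnorm A * norm (B *v t)"
      using norm_mult_vec_le_opnorm[of A "B *v t"] by (simp add: matrix_vector_mul_assoc)
    also have "\<dots> \<le> opnorm A * d" using Bt' A0 by (rule mult_left_mono)
    finally show ?thesis .
  qed
  have expand: "norm (M *v x) \<le> \<bar>inner x s\<bar> * norm (M *v s) + norm x * norm (M *v t)" for M :: "real^2^2" and x
  proof -
    have "M *v x = inner x s *\<^sub>R (M *v s) + inner x t *\<^sub>R (M *v t)"
      using perp_expand[OF t, of x, folded s_def]
      by (metis matrix_vector_mult_scaleR matrix_vector_right_distrib)
    then have "norm (M *v x) \<le> \<bar>inner x s\<bar> * norm (M *v s) + \<bar>inner x t\<bar> * norm (M *v t)"
      by (metis norm_scaleR norm_triangle_ineq)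
    moreover have "\<bar>inner x t\<bar> \<le> norm x" using Cauchy_Schwarz_ineq2[of x t] t by simp
    ultimately show ?thesis by (smt (verit) mult_right_mono norm_ge_zero)
  qed
  have as: "\<bar>\<alpha>\<bar> \<le> norm c" using Cauchy_Schwarz_ineq2[of c s] s by (simp add: \<alpha>_def)
  have Bs: "norm (B *v s) \<le> opnorm B" using norm_mult_vec_le_opnorm[of B s] s by simp
  have Bc: "norm (B *v c) \<le> \<bar>\<alpha>\<bar> * opnorm B + norm c * d"
  proof -
    have "norm (B *v c) \<le> \<bar>\<alpha>\<bar> * norm (B *v s) + norm c * norm (B *v t)"
      unfolding \<alpha>_def by (rule expand)
    also have "\<dots> \<le> \<bar>\<alpha>\<bar> * opnorm B + norm c * d"
      using Bs Bt' by (intro add_mono mult_left_mono) auto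
    finally show ?thesis .
  qed
  have AB: "opnorm (A ** B) \<le> norm ((A ** B) *v s) + opnorm A * d"
  proof (rule opnorm_leI)
    fix x
    have "norm ((A ** B) *v x) \<le> \<bar>inner x s\<bar> * norm ((A ** B) *v s) + norm x * norm ((A ** B) *v t)"
      by (rule expand)
    also have "\<dots> \<le> norm x * norm ((A ** B) *v s) + norm x * (opnorm A * d)"
      using ABt Cauchy_Schwarz_ineq2[of x s] s by (intro add_mono mult_left_mono mult_right_mono) auto
    finally show "norm ((A ** B) *v x) \<le> (norm ((A ** B) *v s) + opnorm A * d) * norm x"
      by (simp add: algebra_simps)
  qed
  have ABc: "\<bar>\<alpha>\<bar> * norm ((A ** B) *v s) \<le> norm ((A ** B) *v c) + norm c * (opnorm A * d)"
  proof -
    have "\<alpha> *\<^sub>R ((A ** B) *v s) = (A ** B) *v c - \<beta> *\<^sub>R ((A ** B) *v t)"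
      using perp_expand[OF t, of c, folded s_def]
      by (metis add_diff_cancel_right' matrix_vector_mult_scaleR matrix_vector_right_distrib \<alpha>_def \<beta>_def)
    then have "\<bar>\<alpha>\<bar> * norm ((A ** B) *v s) \<le> norm ((A ** B) *v c) + \<bar>\<beta>\<bar> * norm ((A ** B) *v t)"
      by (metis norm_scaleR norm_triangle_ineq4)
    also have "\<dots> \<le> norm ((A ** B) *v c) + norm c * (opnorm A * d)"
      using ABt Cauchy_Schwarz_ineq2[of c t] t
      by (intro add_mono mult_mono) (auto simp: \<beta>_def)
    finally show ?thesis .
  qed
  have AB_le: "opnorm (A ** B) \<le> opnorm A * opnorm B" by (rule opnorm_mult_le)
  have "opnorm (A ** B) * norm (B *v c) \<le> opnorm (A ** B) * (\<bar>\<alpha>\<bar> * opnorm B) + opnorm (A ** B) * (norm c * d)"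
    using mult_left_mono[OF Bc opnorm_nonneg[of "A ** B"]] by (simp add: algebra_simps)
  also have "\<dots> \<le> (norm ((A ** B) *v s) + opnorm A * d) * (\<bar>\<alpha>\<bar> * opnorm B) + (opnorm A * opnorm B) * (norm c * d)"
    using AB AB_le d0 pos by (intro add_mono mult_right_mono) auto
  also have "\<dots> = opnorm B * (\<bar>\<alpha>\<bar> * norm ((A ** B) *v s)) + opnorm A * \<bar>\<alpha>\<bar> * (opnorm B * d) + opnorm A * norm c * (opnorm B * d)"
    by (simp add: algebra_simps)
  also have "\<dots> \<le> opnorm B * (norm ((A ** B) *v c) + norm c * (opnorm A * d)) + opnorm A * norm c * 2 + opnorm A * norm c * 2"
    using ABc pos as A0 unfolding dB by (intro add_mono mult_mono) auto
  also have "\<dots> = opnorm B * norm ((A ** B) *v c) + norm c * opnorm A * (opnorm B * d) + 4 * opnorm A * norm c"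
    by (simp add: algebra_simps)
  also have "\<dots> = opnorm B * norm ((A ** B) *v c) + 6 * opnorm A * norm c"
    unfolding dB by simp
  finally show ?thesis .
qed

text \<open>
If \<open>\<parallel>AB\<parallel>\<close> and \<open>\<parallel>BC\<parallel>\<close> are both large, then the norm of the triple product is almost
\<open>\<parallel>AB\<parallel> \<parallel>BC\<parallel> / \<parallel>B\<parallel>\<close>. This propagates the absence of cancellation from neighbouring factors to long products.
\<close>

lemma avalanche_ineq:
  assumes "det B = 1"
  shows "opnorm (A ** B) * opnorm (B ** C) \<le> opnorm B * opnorm (A ** B ** C) + 6 * opnorm A * opnorm C"
proof (cases "opnorm (A ** B) = 0")
  case True
  then show ?thesis by (simp add: opnorm_nonneg)
next
  case False
  then have AB: "0 < opnorm (A ** B)" using opnorm_nonneg[of "A ** B"] by simp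
  have "opnorm (B ** C) \<le> (opnorm B * opnorm (A ** B ** C) + 6 * opnorm A * opnorm C) / opnorm (A ** B)"
  proof (rule opnorm_leI)
    fix x
    have "opnorm (A ** B) * norm ((B ** C) *v x)
        \<le> opnorm B * norm ((A ** B ** C) *v x) + 6 * opnorm A * norm (C *v x)"
      using avalanche_vec[OF assms, of A "C *v x"] by (simp add: matrix_vector_mul_assoc matrix_mul_assoc)
    also have "\<dots> \<le> opnorm B * (opnorm (A ** B ** C) * norm x) + 6 * opnorm A * (opnorm C * norm x)"
      by (intro add_mono mult_left_mono norm_mult_vec_le_opnorm) (auto simp: opnorm_nonneg)
    finally show "norm ((B ** C) *v x)
        \<le> (opnorm B * opnorm (A ** B ** C) + 6 * opnorm A * opnorm C) / opnorm (A ** B) * norm x"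
      using AB by (simp add: field_simps)
  qed
  then show ?thesis using AB by (simp add: field_simps)
qed

section \<open>Growth of cocycle products\<close>

lemma funpow_shift_apply: "(shift ^^ n) \<omega> i = \<omega> (i + int n)"
  by (induction n arbitrary: i) (auto simp: shift_def algebra_simps)

lemma funpow_shift_closed:
  assumes "\<And>\<omega>. \<omega> \<in> \<Omega> \<Longrightarrow> shift \<omega> \<in> \<Omega>" and "\<omega> \<in> \<Omega>"
  shows "(shift ^^ n) \<omega> \<in> \<Omega>"
  using assms(2) by (induction n) (auto simp: assms(1))

lemma funpow_shift_image:
  assumes "shift ` \<Omega> = \<Omega>"
  shows "(shift ^^ n) ` \<Omega> = \<Omega>"
proof (induction n)
  case (Suc n)
  have "(shift ^^ Suc n) ` \<Omega> = shift ` ((shift ^^ n) ` \<Omega>)" by (simp add: image_comp)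
  then show ?case using Suc assms by simp
qed simp

definition growth :: "((int \<Rightarrow> 'a) \<Rightarrow> real^2^2) \<Rightarrow> nat \<Rightarrow> (int \<Rightarrow> 'a) \<Rightarrow> real" where
  "growth A n \<omega> = ln (opnorm (cocycle_iter A n \<omega>))"

lemma cocycle_iter_add:
  "cocycle_iter A (n + m) \<omega> = cocycle_iter A n ((shift ^^ m) \<omega>) ** cocycle_iter A m \<omega>"
proof (induction n)
  case (Suc n)
  have "(shift ^^ n) ((shift ^^ m) \<omega>) = (shift ^^ (n + m)) \<omega>" by (simp add: funpow_add)
  with Suc show ?case by (simp add: matrix_mul_assoc)
qed simp

text \<open>
The bound \<open>K\<close> on the logarithm of the norm also controls the inverse matrices, because the determinant
is one.
\<close>

locale bounded_cocycle =
  fixes \<Omega> :: "(int \<Rightarrow> 'a) set" and A :: "(int \<Rightarrow> 'a) \<Rightarrow> real^2^2" and K :: real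
  assumes shift_in: "\<omega> \<in> \<Omega> \<Longrightarrow> shift \<omega> \<in> \<Omega>"
    and det_1: "\<omega> \<in> \<Omega> \<Longrightarrow> det (A \<omega>) = 1"
    and ln_le_K: "\<omega> \<in> \<Omega> \<Longrightarrow> ln (opnorm (A \<omega>)) \<le> K"
begin

lemma funpow_shift_in: "\<omega> \<in> \<Omega> \<Longrightarrow> (shift ^^ n) \<omega> \<in> \<Omega>"
  by (rule funpow_shift_closed[OF shift_in])

lemma det_iter: "\<omega> \<in> \<Omega> \<Longrightarrow> det (cocycle_iter A n \<omega>) = 1"
  by (induction n) (auto simp: det_mul det_1 funpow_shift_in)

lemma opnorm_iter_ge_1: "\<omega> \<in> \<Omega> \<Longrightarrow> 1 \<le> opnorm (cocycle_iter A n \<omega>)"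
  by (intro opnorm_ge_1 det_iter)

lemma opnorm_iter_eq_exp: "\<omega> \<in> \<Omega> \<Longrightarrow> opnorm (cocycle_iter A n \<omega>) = exp (growth A n \<omega>)"
  using opnorm_iter_ge_1[of \<omega> n] by (simp add: growth_def)

lemma growth_nonneg: "\<omega> \<in> \<Omega> \<Longrightarrow> 0 \<le> growth A n \<omega>"
  using opnorm_iter_ge_1[of \<omega> n] by (simp add: growth_def)

lemma growth_1_le: "\<omega> \<in> \<Omega> \<Longrightarrow> growth A 1 \<omega> \<le> K"
  using ln_le_K by (simp add: growth_def)

lemma growth_add_le:
  assumes "\<omega> \<in> \<Omega>"
  shows "growth A (n + m) \<omega> \<le> growth A n ((shift ^^ m) \<omega>) + growth A m \<omega>"
proof -
  have "exp (growth A (n + m) \<omega>) \<le> exp (growth A n ((shift ^^ m) \<omega>)) * exp (growth A m \<omega>)"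
    using opnorm_mult_le assms
    by (simp add: cocycle_iter_add funpow_shift_in flip: opnorm_iter_eq_exp)
  then show ?thesis by (simp flip: exp_add)
qed

lemma growth_le_add_left:
  assumes "\<omega> \<in> \<Omega>"
  shows "growth A m \<omega> \<le> growth A n ((shift ^^ m) \<omega>) + growth A (n + m) \<omega>"
proof -
  have "exp (growth A m \<omega>) \<le> exp (growth A n ((shift ^^ m) \<omega>)) * exp (growth A (n + m) \<omega>)"
    using opnorm_cancel_left assms
    by (simp add: cocycle_iter_add funpow_shift_in det_iter flip: opnorm_iter_eq_exp)
  then show ?thesis by (simp flip: exp_add)
qed

lemma growth_le_add_right:
  assumes "\<omega> \<in> \<Omega>"
  shows "growth A n ((shift ^^ m) \<omega>) \<le> growth A (n + m) \<omega> + growth A m \<omega>"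
proof -
  have "exp (growth A n ((shift ^^ m) \<omega>)) \<le> exp (growth A (n + m) \<omega>) * exp (growth A m \<omega>)"
    using opnorm_cancel_right assms
    by (simp add: cocycle_iter_add funpow_shift_in det_iter flip: opnorm_iter_eq_exp)
  then show ?thesis by (simp flip: exp_add)
qed

lemma growth_le:
  assumes "\<omega> \<in> \<Omega>"
  shows "growth A n \<omega> \<le> real n * K"
  using assms
proof (induction n arbitrary: \<omega>)
  case 0
  have "opnorm (mat 1 :: real^2^2) \<le> 1" by (rule opnorm_leI) simp
  then show ?case using opnorm_ge_1[of "mat 1"] by (simp add: growth_def)
next
  case (Suc n)
  have "growth A (Suc n) \<omega> \<le> growth A n (shift \<omega>) + growth A 1 \<omega>"
    using growth_add_le[of \<omega> n 1] Suc.prems by simp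
  also have "\<dots> \<le> real n * K + K"
    using Suc by (intro add_mono growth_1_le) (auto simp: shift_in)
  finally show ?case by (simp add: algebra_simps)
qed

text \<open>
Compare both sides with the product over \<open>n + 1\<close> steps: adding or removing a factor at either end
changes the logarithm of the norm by at most \<open>K\<close>.
\<close>

lemma growth_shift_diff:
  assumes "\<omega> \<in> \<Omega>"
  shows "\<bar>growth A n (shift \<omega>) - growth A n \<omega>\<bar> \<le> 2 * K"
proof -
  have "growth A n \<omega> \<le> growth A 1 ((shift ^^ n) \<omega>) + growth A (n + 1) \<omega>"
    using growth_le_add_left[of \<omega> n 1] assms by (simp add: add.commute)
  moreover have "growth A (n + 1) \<omega> \<le> growth A n (shift \<omega>) + growth A 1 \<omega>"
    using growth_add_le[of \<omega> n 1] assms by simp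
  moreover have "growth A n (shift \<omega>) \<le> growth A (n + 1) \<omega> + growth A 1 \<omega>"
    using growth_le_add_right[of \<omega> n 1] assms by simp
  moreover have "growth A (n + 1) \<omega> \<le> growth A 1 ((shift ^^ n) \<omega>) + growth A n \<omega>"
    using growth_add_le[of \<omega> 1 n] assms by simp
  ultimately show ?thesis
    using growth_1_le[OF assms] growth_1_le[OF funpow_shift_in[OF assms, of n]] by linarith
qed

lemma growth_funpow_shift_diff:
  assumes "\<omega> \<in> \<Omega>"
  shows "\<bar>growth A n ((shift ^^ i) \<omega>) - growth A n \<omega>\<bar> \<le> real i * (2 * K)"
proof (induction i)
  case (Suc i)
  have "\<bar>growth A n ((shift ^^ Suc i) \<omega>) - growth A n ((shift ^^ i) \<omega>)\<bar> \<le> 2 * K"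
    using growth_shift_diff[OF funpow_shift_in[OF assms, of i]] by simp
  with Suc show ?case by (simp add: algebra_simps)
qed simp

lemma growth_mult_le:
  assumes "\<And>\<omega>. \<omega> \<in> \<Omega> \<Longrightarrow> growth A m \<omega> \<le> a" and "\<omega> \<in> \<Omega>"
  shows "growth A (k * m) \<omega> \<le> real k * a"
proof (induction k)
  case 0
  then show ?case using growth_le[OF assms(2), of 0] by simp
next
  case (Suc k)
  have "growth A (Suc k * m) \<omega> \<le> growth A m ((shift ^^ (k * m)) \<omega>) + growth A (k * m) \<omega>"
    using growth_add_le[OF assms(2), of m "k * m"] by simp
  also have "\<dots> \<le> a + real k * a"
    using Suc assms by (intro add_mono) (auto simp: funpow_shift_in)
  finally show ?case by (simp add: algebra_simps)
qed

end

section \<open>Uniformity as a condition at finite scales\<close>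

text \<open>
Only the upper bound at scale \<open>m\<close> and the lower bound at scale \<open>2m\<close> are required: the lower bound
excludes cancellation between two consecutive blocks of length \<open>m\<close>. The requirement \<open>1 \<le> m * e\<close> lets constant factors be
absorbed into \<open>exp (m * e)\<close>.
\<close>

definition rigid_at :: "(int \<Rightarrow> 'a) set \<Rightarrow> ((int \<Rightarrow> 'a) \<Rightarrow> real^2^2) \<Rightarrow> real \<Rightarrow> nat \<Rightarrow> bool" where
  "rigid_at \<Omega> A e m \<longleftrightarrow> 1 \<le> real m * e \<and>
     (\<exists>l. \<forall>\<omega>\<in>\<Omega>. growth A m \<omega> \<le> real m * (l + e) \<and>
                   real (2 * m) * (l - e) \<le> growth A (2 * m) \<omega>)"

context bounded_cocycle begin

text \<open>
With \<open>U = exp (m (l + e))\<close>, \<open>V = exp (2 m (l - e))\<close> and \<open>P k\<close> the norm of the product of \<open>k\<close> blocks,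
the avalanche inequality reads \<open>V P (k + 1) \<le> U P (k + 2) + 6 U P k\<close>. The ratio of consecutive terms
is at least \<open>\<rho> = V / (2 U)\<close>, by induction: the last summand costs at most half of the gain, as soon as
\<open>\<rho>\<^sup>2 \<ge> 6\<close>. The hypothesis \<open>6 e \<le> l\<close> ensures this.
\<close>

lemma growth_mult_ge:
  assumes e: "1 \<le> real m * e" and l: "6 * e \<le> l"
    and up: "\<And>\<omega>. \<omega> \<in> \<Omega> \<Longrightarrow> growth A m \<omega> \<le> real m * (l + e)"
    and lo: "\<And>\<omega>. \<omega> \<in> \<Omega> \<Longrightarrow> real (2 * m) * (l - e) \<le> growth A (2 * m) \<omega>"
    and w: "\<omega> \<in> \<Omega>"
  shows "real k * (real m * (l - 4 * e)) \<le> growth A (k * m) \<omega>"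
proof -
  define P where "P k = opnorm (cocycle_iter A (k * m) \<omega>)" for k
  define U V where "U = exp (real m * (l + e))" and "V = exp (real (2 * m) * (l - e))"
  define \<rho> where "\<rho> = V / (2 * U)"
  have pos: "0 < U" "0 < V" "0 < \<rho>" by (simp_all add: U_def V_def \<rho>_def)
  have VU: "V = 2 * \<rho> * U" using pos by (simp add: \<rho>_def)
  have "V / U = exp (real m * (l - 3 * e))"
    unfolding U_def V_def by (simp add: exp_diff[symmetric] algebra_simps)
  then have \<rho>: "\<rho> = exp (real m * (l - 3 * e)) / 2" by (simp add: \<rho>_def)
  have P1: "1 \<le> P k" for k unfolding P_def by (rule opnorm_iter_ge_1[OF w])
  have "3 * (1::real) \<le> 3 * (real m * e)" using e by simp
  also have "\<dots> = real m * (3 * e)" by simp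
  also have "\<dots> \<le> real m * (l - 3 * e)" using l by (intro mult_left_mono) auto
  finally have "exp 3 \<le> exp (real m * (l - 3 * e))" by simp
  moreover have "(8::real) \<le> exp 3"
  proof -
    have "(2::real) ^ 3 \<le> exp 1 ^ 3" using exp_ge_add_one_self[of 1] by (intro power_mono) auto
    then show ?thesis by (simp flip: exp_of_nat_mult)
  qed
  ultimately have \<rho>4: "4 \<le> \<rho>" unfolding \<rho> by linarith
  \<comment> \<open>The avalanche inequality for the blocks number \<open>k + 1\<close> and \<open>k\<close> and the product of all earlier blocks.\<close>
  have step: "V * P (k + 1) \<le> U * P (k + 2) + 6 * U * P k" for k
  proof -
    define B where "B j = cocycle_iter A m ((shift ^^ (j * m)) \<omega>)" for j
    have shj: "(shift ^^ m) ((shift ^^ (k * m)) \<omega>) = (shift ^^ ((k + 1) * m)) \<omega>"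
      by (simp add: funpow_add)
    have in_\<Omega>: "(shift ^^ j) \<omega> \<in> \<Omega>" for j by (rule funpow_shift_in[OF w])
    have BP: "B k ** cocycle_iter A (k * m) \<omega> = cocycle_iter A ((k + 1) * m) \<omega>" for k
      unfolding B_def cocycle_iter_add[symmetric] by (simp add: algebra_simps)
    have BB: "B (k + 1) ** B k = cocycle_iter A (2 * m) ((shift ^^ (k * m)) \<omega>)"
      unfolding B_def shj[symmetric] cocycle_iter_add[symmetric] by (simp add: mult_2)
    have BBP: "B (k + 1) ** B k ** cocycle_iter A (k * m) \<omega> = cocycle_iter A ((k + 2) * m) \<omega>"
      using BP[of "k + 1"] BP[of k] by (simp add: matrix_mul_assoc[symmetric])
    have BU: "opnorm (B j) \<le> U" for j
      unfolding B_def U_def using up[OF in_\<Omega>] by (simp add: opnorm_iter_eq_exp in_\<Omega>)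
    have V: "V \<le> opnorm (B (k + 1) ** B k)"
      unfolding BB V_def using lo[OF in_\<Omega>] by (simp add: opnorm_iter_eq_exp in_\<Omega>)
    have "det (B k) = 1" unfolding B_def by (rule det_iter[OF in_\<Omega>])
    from avalanche_ineq[OF this, of "B (k + 1)" "cocycle_iter A (k * m) \<omega>"]
    have "opnorm (B (k + 1) ** B k) * P (k + 1) \<le> opnorm (B k) * P (k + 2) + 6 * opnorm (B (k + 1)) * P k"
      unfolding BBP BP P_def .
    moreover have "V * P (k + 1) \<le> opnorm (B (k + 1) ** B k) * P (k + 1)"
      using V P1[of "k + 1"] by (intro mult_right_mono) auto
    moreover have "opnorm (B k) * P (k + 2) \<le> U * P (k + 2)"
      using BU P1[of "k + 2"] by (intro mult_right_mono) auto
    moreover have "6 * opnorm (B (k + 1)) * P k \<le> 6 * U * P k"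
      using BU[of "k + 1"] P1[of k] by (intro mult_right_mono) auto
    ultimately show ?thesis by linarith
  qed
  have grow: "\<rho> * P k \<le> P (k + 1)" for k
  proof (induction k)
    case 0
    have "real (2 * m) * (l - e) \<le> growth A m ((shift ^^ m) \<omega>) + growth A m \<omega>"
      using lo[OF w] growth_add_le[OF w, of m m, folded mult_2] by linarith
    also have "\<dots> \<le> real m * (l + e) + growth A m \<omega>"
      using up[OF funpow_shift_in[OF w]] by simp
    finally have "V \<le> U * exp (growth A m \<omega>)"
      unfolding U_def V_def exp_add[symmetric] by simp
    then have "2 * \<rho> * U \<le> U * P 1" by (simp add: VU P_def opnorm_iter_eq_exp[OF w])
    then have "2 * \<rho> \<le> P 1" using pos by (simp add: mult.commute)
    moreover have "P 0 = exp (growth A 0 \<omega>)" by (simp add: P_def opnorm_iter_eq_exp[OF w] del: cocycle_iter.simps)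
    then have "P 0 = 1" using growth_le[OF w, of 0] growth_nonneg[OF w, of 0] by simp
    ultimately show ?case using pos by simp
  next
    case (Suc k)
    have "U * (2 * \<rho> * P (k + 1)) \<le> U * (P (k + 2) + 6 * P k)"
      using step[of k] unfolding VU by (simp add: algebra_simps)
    then have "2 * \<rho> * P (k + 1) \<le> P (k + 2) + 6 * P k" using pos by simp
    moreover have "6 * P k \<le> \<rho> * (\<rho> * P k)"
    proof -
      have "4 * 4 \<le> \<rho> * \<rho>" using \<rho>4 by (intro mult_mono) auto
      then have "6 * P k \<le> (\<rho> * \<rho>) * P k" using P1[of k] by (intro mult_right_mono) auto
      then show ?thesis by simp
    qed
    moreover have "\<rho> * (\<rho> * P k) \<le> \<rho> * P (k + 1)" using Suc pos by simp
    ultimately show ?case by simp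
  qed
  have pow: "\<rho> ^ k \<le> P k"
  proof (induction k)
    case 0 then show ?case using P1[of 0] by simp
  next
    case (Suc k)
    have "\<rho> * \<rho> ^ k \<le> \<rho> * P k" using Suc pos by simp
    also have "\<dots> \<le> P (k + 1)" by (rule grow)
    finally show ?case by simp
  qed
  have "2 \<le> exp (real m * e)" using exp_ge_add_one_self[of "real m * e"] e by linarith
  then have "exp (real m * (l - 4 * e)) * 2 \<le> exp (real m * (l - 4 * e)) * exp (real m * e)"
    by (intro mult_left_mono) auto
  also have "\<dots> = exp (real m * (l - 3 * e))" by (simp flip: exp_add add: algebra_simps)
  finally have "exp (real m * (l - 4 * e)) \<le> \<rho>" by (simp add: \<rho>)
  then have "exp (real m * (l - 4 * e)) ^ k \<le> \<rho> ^ k" by (intro power_mono) auto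
  also note pow
  finally show ?thesis by (simp add: P_def opnorm_iter_eq_exp[OF w] flip: exp_of_nat_mult)
qed

text \<open>
If \<open>l\<close> is small compared with \<open>e\<close>, then the lower bound is just that norms are at least one;
otherwise it is \<open>growth_mult_ge\<close>. A remainder of less than \<open>m\<close> steps is negligible.
\<close>

lemma rigid_at_imp_near_constant:
  assumes "rigid_at \<Omega> A e m"
  obtains l where "\<forall>\<^sub>F n in sequentially. \<forall>\<omega>\<in>\<Omega>. \<bar>growth A n \<omega> / real n - l\<bar> \<le> 7 * e"
proof (cases "\<Omega> = {}")
  case True
  then show ?thesis by (intro that[of 0]) simp
next
  case False
  then obtain \<omega>0 where w0: "\<omega>0 \<in> \<Omega>" by blast
  from assms obtain l where me: "1 \<le> real m * e"
    and up: "\<And>\<omega>. \<omega> \<in> \<Omega> \<Longrightarrow> growth A m \<omega> \<le> real m * (l + e)"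
    and lo: "\<And>\<omega>. \<omega> \<in> \<Omega> \<Longrightarrow> real (2 * m) * (l - e) \<le> growth A (2 * m) \<omega>"
    unfolding rigid_at_def by blast
  have m0: "0 < m" using me by (cases m) auto
  have e0: "0 < e" using me m0 by (smt (verit) mult_nonneg_nonpos of_nat_0_le_iff)
  have K0: "0 \<le> K" using growth_1_le[OF w0] growth_nonneg[OF w0, of 1] by simp
  have "0 \<le> real m * (l + e)" using up[OF w0] growth_nonneg[OF w0, of m] by simp
  then have le0: "0 \<le> l + e" using m0 by (simp add: zero_le_mult_iff)
  \<comment> \<open>A bound for everything that the incomplete last block can contribute.\<close>
  define c where "c = real m * (\<bar>l\<bar> + 4 * e + K)"
  have c0: "0 \<le> c" using e0 K0 by (simp add: c_def)
  have "\<bar>growth A n \<omega> / real n - l\<bar> \<le> 7 * e" if n: "nat \<lceil>c / e\<rceil> + 1 \<le> n" and w: "\<omega> \<in> \<Omega>" for n \<omega>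
  proof -
    have n0: "0 < n" using n by simp
    have "c / e \<le> real n" using n by linarith
    then have cn: "c \<le> real n * e" using e0 by (simp add: field_simps)
    define k r where "k = n div m" and "r = n mod m"
    have nkr: "n = k * m + r" and rm: "r < m" using m0 by (simp_all add: k_def r_def)
    have rK: "real r * K \<le> real m * K" using rm K0 by (intro mult_right_mono) auto
    have kn: "real (k * m) \<le> real n" "real n - real m \<le> real (k * m)" using nkr rm by linarith+
    have gr: "growth A r ((shift ^^ (k * m)) \<omega>) \<le> real m * K"
      using growth_le[OF funpow_shift_in[OF w, of "k * m"], of r] rK by linarith
    have "growth A n \<omega> \<le> growth A r ((shift ^^ (k * m)) \<omega>) + growth A (k * m) \<omega>"
      using growth_add_le[OF w, of r "k * m"] by (simp add: nkr add.commute)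
    also have "\<dots> \<le> real m * K + real k * (real m * (l + e))"
      using gr growth_mult_le[OF up w, of k] by linarith
    also have "real k * (real m * (l + e)) \<le> real n * (l + e)"
      using kn(1) le0 mult_right_mono by fastforce
    finally have upper: "growth A n \<omega> \<le> real n * (l + e) + real m * K" by simp
    have "real m * K \<le> c" using e0 by (simp add: c_def mult_left_mono)
    then have U: "growth A n \<omega> \<le> real n * (l + 2 * e)"
      using upper cn by (simp add: algebra_simps)
    have L: "real n * (l - 7 * e) \<le> growth A n \<omega>"
    proof (cases "6 * e \<le> l")
      case True
      have "growth A (k * m) \<omega> \<le> growth A r ((shift ^^ (k * m)) \<omega>) + growth A n \<omega>"
        using growth_le_add_left[OF w, of "k * m" r] by (simp add: nkr add.commute)
      then have "real k * (real m * (l - 4 * e)) - real m * K \<le> growth A n \<omega>"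
        using growth_mult_ge[OF me True up lo w, of k] gr by linarith
      moreover have "(real n - real m) * (l - 4 * e) \<le> real (k * m) * (l - 4 * e)"
        using kn(2) True e0 by (intro mult_right_mono) auto
      ultimately have "real n * (l - 4 * e) - real m * (l - 4 * e) - real m * K \<le> growth A n \<omega>"
        by (simp add: algebra_simps)
      moreover have "real m * (l - 4 * e) + real m * K \<le> c"
        unfolding c_def distrib_left[symmetric] using e0 by (intro mult_left_mono) auto
      ultimately have "real n * (l - 4 * e) - real n * e \<le> growth A n \<omega>" using cn by linarith
      moreover have "0 \<le> real n * (2 * e)" using e0 by simp
      ultimately show ?thesis by (simp add: algebra_simps)
    next
      case False
      then have "real n * (l - 7 * e) \<le> 0" using e0 by (intro mult_nonneg_nonpos) auto
      then show ?thesis using growth_nonneg[OF w, of n] by linarith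
    qed
    have "growth A n \<omega> / real n \<le> l + 2 * e" using U n0 by (simp add: field_simps)
    moreover have "l - 7 * e \<le> growth A n \<omega> / real n" using L n0 by (simp add: field_simps)
    ultimately show ?thesis using e0 by (simp add: abs_le_iff)
  qed
  then have "\<forall>\<^sub>F n in sequentially. \<forall>\<omega>\<in>\<Omega>. \<bar>growth A n \<omega> / real n - l\<bar> \<le> 7 * e"
    unfolding eventually_sequentially by blast
  then show ?thesis by (rule that)
qed

theorem uniform_cocycle_iff_rigid:
  assumes ne: "\<Omega> \<noteq> {}"
  shows "uniform_cocycle \<Omega> A \<longleftrightarrow> (\<forall>e>0. \<exists>m. rigid_at \<Omega> A e m)"
proof
  assume "uniform_cocycle \<Omega> A"
  then obtain L where L: "uniform_limit \<Omega> (\<lambda>n \<omega>. growth A n \<omega> / real n) (\<lambda>_. L) sequentially"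
    unfolding uniform_cocycle_def growth_def opnorm_def by auto
  show "\<forall>e>0. \<exists>m. rigid_at \<Omega> A e m"
  proof (intro allI impI)
    fix e :: real assume e: "0 < e"
    from uniform_limitD[OF L e] obtain n0
      where n0: "\<And>n \<omega>. n0 \<le> n \<Longrightarrow> \<omega> \<in> \<Omega> \<Longrightarrow> \<bar>growth A n \<omega> / real n - L\<bar> < e"
      unfolding eventually_sequentially dist_real_def by blast
    define m where "m = n0 + nat \<lceil>1 / e\<rceil> + 1"
    have "1 / e \<le> real m" unfolding m_def by linarith
    then have me: "1 \<le> real m * e" using e by (simp add: field_simps)
    have "growth A m \<omega> \<le> real m * (L + e) \<and> real (2 * m) * (L - e) \<le> growth A (2 * m) \<omega>" if "\<omega> \<in> \<Omega>" for \<omega>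
    proof
      have mp: "0 < real m" "0 < real (2 * m)" by (simp_all add: m_def)
      have "growth A m \<omega> / real m \<le> L + e" using n0[OF _ that, of m] unfolding m_def by linarith
      then show "growth A m \<omega> \<le> real m * (L + e)" using mp(1) by (simp add: pos_divide_le_eq mult.commute)
      have "n0 \<le> 2 * m" by (simp add: m_def)
      from n0[OF this that] have "L - e \<le> growth A (2 * m) \<omega> / real (2 * m)" by linarith
      then show "real (2 * m) * (L - e) \<le> growth A (2 * m) \<omega>"
        using mp(2) by (simp add: pos_le_divide_eq mult.commute)
    qed
    with me show "\<exists>m. rigid_at \<Omega> A e m" unfolding rigid_at_def by blast
  qed
next
  assume R: "\<forall>e>0. \<exists>m. rigid_at \<Omega> A e m"
  obtain \<omega>0 where w0: "\<omega>0 \<in> \<Omega>" using ne by blast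
  define g where "g n \<omega> = growth A n \<omega> / real n" for n \<omega>
  have near: "\<exists>N. \<forall>n\<ge>N. \<forall>n'\<ge>N. \<forall>\<omega>\<in>\<Omega>. \<forall>\<omega>'\<in>\<Omega>. \<bar>g n \<omega> - g n' \<omega>'\<bar> < e" if "0 < e" for e
  proof -
    obtain m where "rigid_at \<Omega> A (e / 15) m" using R[rule_format, of "e / 15"] \<open>0 < e\<close> by auto
    then obtain l where "\<forall>\<^sub>F n in sequentially. \<forall>\<omega>\<in>\<Omega>. \<bar>growth A n \<omega> / real n - l\<bar> \<le> 7 * (e / 15)"
      by (rule rigid_at_imp_near_constant)
    then obtain N where N: "\<And>n \<omega>. N \<le> n \<Longrightarrow> \<omega> \<in> \<Omega> \<Longrightarrow> \<bar>g n \<omega> - l\<bar> \<le> 7 * (e / 15)"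
      unfolding eventually_sequentially g_def by blast
    have "\<bar>g n \<omega> - g n' \<omega>'\<bar> < e" if "N \<le> n" "N \<le> n'" "\<omega> \<in> \<Omega>" "\<omega>' \<in> \<Omega>" for n n' \<omega> \<omega>'
      using N[OF that(1,3)] N[OF that(2,4)] \<open>0 < e\<close> by linarith
    then show ?thesis by blast
  qed
  have "Cauchy (\<lambda>n. g n \<omega>0)"
    unfolding Cauchy_def dist_real_def using near w0 by blast
  then obtain L where L: "(\<lambda>n. g n \<omega>0) \<longlonglongrightarrow> L"
    using real_Cauchy_convergent convergent_def by blast
  have "uniform_limit \<Omega> g (\<lambda>_. L) sequentially"
  proof (rule uniform_limitI)
    fix e :: real assume e: "0 < e"
    obtain N where N: "\<forall>n\<ge>N. \<forall>n'\<ge>N. \<forall>\<omega>\<in>\<Omega>. \<forall>\<omega>'\<in>\<Omega>. \<bar>g n \<omega> - g n' \<omega>'\<bar> < e / 2"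
      using near[of "e / 2"] e by auto
    obtain N' where N': "\<And>n. N' \<le> n \<Longrightarrow> \<bar>g n \<omega>0 - L\<bar> < e / 2"
      using LIMSEQ_D[OF L, of "e / 2"] e by auto
    have "\<bar>g n \<omega> - L\<bar> < e" if "N \<le> n" "\<omega> \<in> \<Omega>" for n \<omega>
    proof -
      have "\<bar>g n \<omega> - g (max N N') \<omega>0\<bar> < e / 2" using N that w0 by auto
      then show ?thesis using N'[of "max N N'"] by (simp add: abs_if split: if_splits)
    qed
    then show "\<forall>\<^sub>F n in sequentially. \<forall>\<omega>\<in>\<Omega>. dist (g n \<omega>) L < e"
      unfolding eventually_sequentially dist_real_def by blast
  qed
  then show "uniform_cocycle \<Omega> A"
    unfolding uniform_cocycle_def g_def growth_def opnorm_def by auto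
qed

end

section \<open>Almost invariance of subadditive averages\<close>

text \<open>
Subadditive sequences of functions over a measure preserving map, such as \<open>growth A\<close>. The last
condition says that the functions change slowly along orbits, at a speed that does not depend on \<open>n\<close>.
\<close>

locale subadditive_process = prob_space M for M :: "'b measure" +
  fixes T :: "'b \<Rightarrow> 'b" and F :: "nat \<Rightarrow> 'b \<Rightarrow> real" and K :: real
  assumes T_meas [measurable]: "T \<in> measurable M M"
    and T_inv: "distr M M T = M"
    and F_meas [measurable]: "F n \<in> borel_measurable M"
    and F_nonneg: "x \<in> space M \<Longrightarrow> 0 \<le> F n x"
    and F_le: "x \<in> space M \<Longrightarrow> F n x \<le> real n * K"
    and F_subadd: "x \<in> space M \<Longrightarrow> F (n + m) x \<le> F n ((T ^^ m) x) + F m x"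
    and F_slow: "x \<in> space M \<Longrightarrow> \<bar>F n ((T ^^ i) x) - F n x\<bar> \<le> real i * (2 * K)"
begin

lemma funpow_T_meas [measurable]: "T ^^ i \<in> measurable M M"
  by (induction i) (auto simp: o_def)

lemma funpow_T_space: "x \<in> space M \<Longrightarrow> (T ^^ i) x \<in> space M"
  using funpow_T_meas[of i] by (rule measurable_space)

lemma integral_funpow_T:
  fixes g :: "'b \<Rightarrow> real"
  assumes [measurable]: "g \<in> borel_measurable M"
  shows "(\<integral>x. g ((T ^^ i) x) \<partial>M) = (\<integral>x. g x \<partial>M)"
proof (induction i)
  case (Suc i)
  have "(\<integral>x. g ((T ^^ Suc i) x) \<partial>M) = (\<integral>x. g ((T ^^ i) (T x)) \<partial>M)"
    by (simp only: funpow_Suc_right o_apply)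
  also have "\<dots> = (\<integral>x. g ((T ^^ i) x) \<partial>distr M M T)"
    by (subst integral_distr) auto
  finally show ?case using Suc T_inv by simp
qed simp

definition rate :: "nat \<Rightarrow> 'b \<Rightarrow> real" where "rate n x = F n x / real n"

definition energy :: "nat \<Rightarrow> real" where "energy n = (\<integral>x. (rate n x)\<^sup>2 \<partial>M)"

lemma rate_meas [measurable]: "rate n \<in> borel_measurable M"
  unfolding rate_def[abs_def] by measurable

lemma rate_nonneg: "x \<in> space M \<Longrightarrow> 0 \<le> rate n x"
  by (simp add: rate_def F_nonneg)

lemma K_nonneg: "0 \<le> K"
proof -
  obtain x where "x \<in> space M" using not_empty by blast
  then show ?thesis using F_nonneg[of x 1] F_le[of x 1] by simp
qed

lemma rate_le: "x \<in> space M \<Longrightarrow> rate n x \<le> K"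
  using F_le[of x n] K_nonneg by (cases "n = 0") (simp_all add: rate_def field_simps)

lemma integrable_bounded:
  fixes g :: "'b \<Rightarrow> real"
  assumes "g \<in> borel_measurable M" "\<And>x. x \<in> space M \<Longrightarrow> \<bar>g x\<bar> \<le> B"
  shows "integrable M g"
  using assms by (intro integrable_const_bound[of _ B]) (auto intro!: AE_I2)

lemma F_mult_le:
  assumes "x \<in> space M"
  shows "F (q * m) x \<le> (\<Sum>l<q. F m ((T ^^ (l * m)) x))"
proof (induction q)
  case 0
  then show ?case using F_le[OF assms, of 0] by simp
next
  case (Suc q)
  have "F (Suc q * m) x \<le> F m ((T ^^ (q * m)) x) + F (q * m) x"
    using F_subadd[OF assms, of m "q * m"] by simp
  with Suc show ?case by simp
qed

lemma integrable_sq: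
  fixes g :: "'b \<Rightarrow> real"
  assumes g: "g \<in> borel_measurable M" and b: "\<And>x. x \<in> space M \<Longrightarrow> \<bar>g x\<bar> \<le> B"
  shows "integrable M (\<lambda>x. (g x)\<^sup>2)"
proof (rule integrable_bounded[where B = "B\<^sup>2"])
  show "(\<lambda>x. (g x)\<^sup>2) \<in> borel_measurable M" using g by measurable
  show "\<bar>(g x)\<^sup>2\<bar> \<le> B\<^sup>2" if "x \<in> space M" for x
    using power_mono[OF b[OF that], of 2] by simp
qed

text \<open>
By slow variation, \<open>rate (q * m)\<close> is nearly its own average over the two points \<open>x\<close> and \<open>T\<^sup>i x\<close>; by
subadditivity that average is at most the mean, over \<open>q\<close> blocks, of the function whose square is
integrated on the right. Squares of means are at most means of squares, and the measure is invariant.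
\<close>

lemma energy_mult_le:
  assumes m: "1 \<le> m" and q: "1 \<le> q"
  shows "energy (q * m) \<le> (\<integral>x. ((rate m x + rate m ((T ^^ i) x)) / 2)\<^sup>2 \<partial>M)
           + 2 * K * (real i * K / real (q * m)) + (real i * K / real (q * m))\<^sup>2"
proof -
  define k where "k x = (rate m x + rate m ((T ^^ i) x)) / 2" for x
  define d where "d = real i * K / real (q * m)"
  have d0: "0 \<le> d" using K_nonneg by (simp add: d_def)
  have [measurable]: "k \<in> borel_measurable M" unfolding k_def[abs_def] by measurable
  have k: "0 \<le> k x" "k x \<le> K" if "x \<in> space M" for x
    using rate_nonneg[OF that, of m] rate_nonneg[OF funpow_T_space[OF that], of m i]
      rate_le[OF that, of m] rate_le[OF funpow_T_space[OF that], of m i] by (auto simp: k_def)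
  define avg where "avg x = (\<Sum>l<q. k ((T ^^ (l * m)) x)) / real q" for x
  have avg: "0 \<le> avg x" "avg x \<le> K" if "x \<in> space M" for x
  proof -
    show "0 \<le> avg x" unfolding avg_def using that by (intro divide_nonneg_nonneg sum_nonneg k funpow_T_space) auto
    have "(\<Sum>l<q. k ((T ^^ (l * m)) x)) \<le> (\<Sum>l<q. K)" using that by (intro sum_mono k funpow_T_space)
    then show "avg x \<le> K" using q by (simp add: avg_def field_simps)
  qed
  have sub: "rate (q * m) x \<le> (\<Sum>l<q. rate m ((T ^^ (l * m)) x)) / real q" if "x \<in> space M" for x
  proof -
    have "(\<Sum>l<q. rate m ((T ^^ (l * m)) x)) / real q = (\<Sum>l<q. F m ((T ^^ (l * m)) x)) / real (q * m)"
      by (simp add: rate_def sum_divide_distrib[symmetric] mult.commute)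
    then show ?thesis using F_mult_le[OF that, of q m] m q
      unfolding rate_def by (simp only: divide_right_mono of_nat_0_le_iff)
  qed
  have pt: "rate (q * m) x \<le> avg x + d" if x: "x \<in> space M" for x
  proof -
    have "F (q * m) x \<le> F (q * m) ((T ^^ i) x) + real i * (2 * K)"
      using F_slow[OF x, of "q * m" i] by linarith
    then have "rate (q * m) x \<le> (F (q * m) ((T ^^ i) x) + real i * (2 * K)) / real (q * m)"
      unfolding rate_def by (rule divide_right_mono) simp
    then have "rate (q * m) x \<le> rate (q * m) ((T ^^ i) x) + 2 * d"
      by (simp add: rate_def d_def add_divide_distrib mult_ac)
    moreover have "(rate (q * m) x + rate (q * m) ((T ^^ i) x)) / 2 \<le> avg x"
    proof -
      have "rate (q * m) x + rate (q * m) ((T ^^ i) x)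
         \<le> (\<Sum>l<q. rate m ((T ^^ (l * m)) x)) / real q + (\<Sum>l<q. rate m ((T ^^ (l * m)) ((T ^^ i) x))) / real q"
        by (intro add_mono sub funpow_T_space x)
      also have "\<dots> = (\<Sum>l<q. 2 * k ((T ^^ (l * m)) x)) / real q"
      proof -
        have "(T ^^ (l * m)) ((T ^^ i) x) = (T ^^ i) ((T ^^ (l * m)) x)" for l
          by (metis add.commute comp_apply funpow_add)
        then show ?thesis
          unfolding add_divide_distrib[symmetric] sum.distrib[symmetric]
          by (simp add: k_def add_divide_distrib)
      qed
      finally show ?thesis by (simp add: avg_def sum_distrib_left[symmetric] mult.commute)
    qed
    ultimately show ?thesis by argo
  qed
  have sq: "(rate (q * m) x)\<^sup>2 \<le> (\<Sum>l<q. (k ((T ^^ (l * m)) x))\<^sup>2) / real q + (2 * K * d + d\<^sup>2)" if x: "x \<in> space M" for x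
  proof -
    have "(rate (q * m) x)\<^sup>2 \<le> (avg x + d)\<^sup>2" using pt[OF x] rate_nonneg[OF x] by (intro power_mono)
    also have "\<dots> = (avg x)\<^sup>2 + (2 * avg x * d + d\<^sup>2)" by (simp add: power2_eq_square algebra_simps)
    also have "\<dots> \<le> (avg x)\<^sup>2 + (2 * K * d + d\<^sup>2)" using avg[OF x] d0 by (intro add_mono mult_right_mono) auto
    also have "(avg x)\<^sup>2 \<le> (\<Sum>l<q. (k ((T ^^ (l * m)) x))\<^sup>2) / real q"
    proof -
      have "(\<Sum>l<q. k ((T ^^ (l * m)) x))\<^sup>2 \<le> (\<Sum>l<q. (k ((T ^^ (l * m)) x))\<^sup>2) * real q"
        using sum_squared_le_sum_of_squares[of "\<lambda>l. k ((T ^^ (l * m)) x)" "{..<q}"] by simp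
      then show ?thesis using q by (simp add: avg_def power_divide field_simps power2_eq_square)
    qed
    finally show ?thesis by simp
  qed
  have int_k: "integrable M (\<lambda>x. (k ((T ^^ j) x))\<^sup>2)" for j
    using k funpow_T_space by (intro integrable_sq[where B = K]) auto
  have "energy (q * m) \<le> (\<integral>x. (\<Sum>l<q. (k ((T ^^ (l * m)) x))\<^sup>2) / real q + (2 * K * d + d\<^sup>2) \<partial>M)"
    unfolding energy_def
  proof (rule integral_mono)
    show "integrable M (\<lambda>x. (rate (q * m) x)\<^sup>2)"
      using rate_nonneg rate_le by (intro integrable_sq[where B = K]) auto
    show "integrable M (\<lambda>x. (\<Sum>l<q. (k ((T ^^ (l * m)) x))\<^sup>2) / real q + (2 * K * d + d\<^sup>2))"
      by (intro Bochner_Integration.integrable_add integrable_divide Bochner_Integration.integrable_sum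
          int_k integrable_const)
  qed (rule sq)
  also have "\<dots> = (\<Sum>l<q. \<integral>x. (k ((T ^^ (l * m)) x))\<^sup>2 \<partial>M) / real q + (2 * K * d + d\<^sup>2)"
    using int_k by (subst Bochner_Integration.integral_add)
      (auto simp: prob_space intro!: integrable_divide Bochner_Integration.integrable_sum)
  also have "\<dots> = (\<integral>x. (k x)\<^sup>2 \<partial>M) + (2 * K * d + d\<^sup>2)"
    using q integral_funpow_T[of "\<lambda>x. (k x)\<^sup>2"] by simp
  finally show ?thesis by (simp add: k_def d_def)
qed

text \<open>
Let \<open>D\<close> be the infimum of the energies. Letting \<open>q \<rightarrow> \<infinity>\<close> in \<open>energy_mult_le\<close> shows that the average of
\<open>rate m\<close> and \<open>rate m \<circ> T\<^sup>i\<close> has mean square at least \<open>D\<close>. Both functions have mean square \<open>energy m\<close>, so by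
the parallelogram law their difference has mean square at most \<open>4 (energy m - D)\<close>. Choose \<open>m1\<close> with
energy close to \<open>D\<close>; its multiples have no larger energy.
\<close>

theorem ex_almost_invariant_scale:
  assumes "0 < \<eta>"
  obtains D m1 where "1 \<le> m1"
    "\<And>q. 1 \<le> q \<Longrightarrow> D \<le> energy (q * m1) \<and> energy (q * m1) \<le> D + \<eta>"
    "\<And>q i. 1 \<le> q \<Longrightarrow> (\<integral>x. (rate (q * m1) ((T ^^ i) x) - rate (q * m1) x)\<^sup>2 \<partial>M) \<le> \<eta>"
proof -
  define D where "D = (INF n\<in>{1..}. energy n)"
  have bdd: "bdd_below (energy ` {1..})" by (rule bdd_belowI[of _ 0]) (auto simp: energy_def)
  have D_le: "D \<le> energy n" if "1 \<le> n" for n unfolding D_def using bdd that by (intro cINF_lower) auto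
  have "\<exists>y\<in>energy ` {1..}. y < D + \<eta> / 4"
    using cInf_lessD[of "energy ` {1..}" "D + \<eta> / 4"] assms by (auto simp: D_def)
  then obtain m1 where m1: "1 \<le> m1" "energy m1 < D + \<eta> / 4" by auto
  have mono: "energy (q * m1) \<le> energy m1" if "1 \<le> q" for q
    using energy_mult_le[OF m1(1) that, of 0] by (simp add: energy_def)
  have D_k: "D \<le> (\<integral>x. ((rate m x + rate m ((T ^^ i) x)) / 2)\<^sup>2 \<partial>M)" (is "D \<le> ?I") if m: "1 \<le> m" for m i
  proof -
    have "(\<lambda>q. ?I + 2 * K * (real i * K / real (q * m)) + (real i * K / real (q * m))\<^sup>2) \<longlonglongrightarrow> ?I + 2 * K * 0 + 0\<^sup>2"
    proof -
      have "(\<lambda>q. (real i * K / real m) / real q) \<longlonglongrightarrow> 0"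
        by (rule lim_const_over_n)
      then have "(\<lambda>q. real i * K / real (q * m)) \<longlonglongrightarrow> 0" by (simp add: mult.commute)
      then show ?thesis by (intro tendsto_intros)
    qed
    moreover have "D \<le> ?I + 2 * K * (real i * K / real (q * m)) + (real i * K / real (q * m))\<^sup>2" if "1 \<le> q" for q
    proof -
      have "1 \<le> q * m" using that m by (simp add: Suc_le_eq)
      then show ?thesis using D_le[of "q * m"] energy_mult_le[OF m that, of i] by linarith
    qed
    ultimately have "D \<le> ?I + 2 * K * 0 + 0\<^sup>2" by (intro LIMSEQ_le_const) auto
    then show ?thesis by simp
  qed
  have inv: "(\<integral>x. (rate m ((T ^^ i) x) - rate m x)\<^sup>2 \<partial>M) \<le> 4 * (energy m - D)" if m: "1 \<le> m" for m i
  proof -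
    have b: "\<bar>rate m ((T ^^ j) x)\<bar> \<le> K" if "x \<in> space M" for x j
      using rate_nonneg[OF funpow_T_space[OF that]] rate_le[OF funpow_T_space[OF that]] by (simp add: abs_of_nonneg)
    have i1: "integrable M (\<lambda>x. (rate m ((T ^^ j) x))\<^sup>2)" for j
      using b by (intro integrable_sq[where B = K]) auto
    have i2: "integrable M (\<lambda>x. ((rate m x + rate m ((T ^^ i) x)) / 2)\<^sup>2)"
    proof (rule integrable_sq[where B = K])
      show "\<bar>(rate m x + rate m ((T ^^ i) x)) / 2\<bar> \<le> K" if "x \<in> space M" for x
        using b[OF that, of 0] b[OF that, of i] by simp
    qed measurable
    define J where "J = (\<integral>x. ((rate m x + rate m ((T ^^ i) x)) / 2)\<^sup>2 \<partial>M)"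
    have "(\<integral>x. (rate m ((T ^^ i) x) - rate m x)\<^sup>2 \<partial>M)
       = (\<integral>x. 2 * (rate m ((T ^^ i) x))\<^sup>2 + 2 * (rate m x)\<^sup>2 - 4 * ((rate m x + rate m ((T ^^ i) x)) / 2)\<^sup>2 \<partial>M)"
      by (intro Bochner_Integration.integral_cong) (auto simp: power2_eq_square field_simps)
    also have "\<dots> = 2 * (\<integral>x. (rate m ((T ^^ i) x))\<^sup>2 \<partial>M) + 2 * energy m - 4 * (\<integral>x. ((rate m x + rate m ((T ^^ i) x)) / 2)\<^sup>2 \<partial>M)"
      using i1[of i] i1[of 0] i2
      by (simp only: Bochner_Integration.integral_diff Bochner_Integration.integral_add integrable_mult_right
          Bochner_Integration.integrable_add integral_mult_right_zero energy_def funpow_0 id_apply)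
    also have "(\<integral>x. (rate m ((T ^^ i) x))\<^sup>2 \<partial>M) = energy m"
      using integral_funpow_T[of "\<lambda>x. (rate m x)\<^sup>2" i] by (simp add: energy_def)
    finally have eq: "(\<integral>x. (rate m ((T ^^ i) x) - rate m x)\<^sup>2 \<partial>M) = 2 * energy m + 2 * energy m - 4 * J"
      by (simp only: J_def)
    show ?thesis unfolding eq using D_k[OF m, of i, folded J_def] by simp
  qed
  show thesis
  proof (rule that[of m1 D])
    fix q :: nat assume q: "1 \<le> q"
    have qm: "1 \<le> q * m1" using q m1(1) by (simp add: Suc_le_eq)
    show "D \<le> energy (q * m1) \<and> energy (q * m1) \<le> D + \<eta>"
      using D_le[OF qm] mono[OF q] m1(2) assms by linarith
    show "(\<integral>x. (rate (q * m1) ((T ^^ i) x) - rate (q * m1) x)\<^sup>2 \<partial>M) \<le> \<eta>" for i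
      by (rule order_trans[OF inv[OF qm, of i]]) (use mono[OF q] m1(2) in argo)
  qed (rule m1(1))
qed

end

section \<open>Words and the functions they determine\<close>

lemma length_prefix_word [simp]: "length (prefix_word n \<omega>) = n"
  by (simp add: prefix_word_def)

lemma nth_prefix_word [simp]: "i < n \<Longrightarrow> prefix_word n \<omega> ! i = \<omega> (1 + int i)"
  by (simp add: prefix_word_def)

lemma prefix_word_eq_iff:
  "prefix_word n x = prefix_word n y \<longleftrightarrow> (\<forall>i<n. x (1 + int i) = y (1 + int i))"
  by (simp add: list_eq_iff_nth_eq)

lemma prefix_word_mono:
  "prefix_word n x = prefix_word n y \<Longrightarrow> k \<le> n \<Longrightarrow> prefix_word k x = prefix_word k y"
  by (auto simp: prefix_word_eq_iff)

lemma prefix_word_funpow_shift: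
  assumes "prefix_word n x = prefix_word n y" "k + i \<le> n"
  shows "prefix_word k ((shift ^^ i) x) = prefix_word k ((shift ^^ i) y)"
proof -
  have "x (1 + int j + int i) = y (1 + int j + int i)" if "j < k" for j
    using assms that unfolding prefix_word_eq_iff
    by (auto dest!: spec[of _ "j + i"] simp: add.assoc)
  then show ?thesis by (simp add: prefix_word_eq_iff funpow_shift_apply)
qed

definition determined_by :: "(int \<Rightarrow> 'a) set \<Rightarrow> nat \<Rightarrow> ((int \<Rightarrow> 'a) \<Rightarrow> 'b) \<Rightarrow> bool" where
  "determined_by \<Omega> n g \<longleftrightarrow> (\<forall>x\<in>\<Omega>. \<forall>y\<in>\<Omega>. prefix_word n x = prefix_word n y \<longrightarrow> g x = g y)"

lemma determined_byD:
  "determined_by \<Omega> n g \<Longrightarrow> x \<in> \<Omega> \<Longrightarrow> y \<in> \<Omega> \<Longrightarrow> prefix_word n x = prefix_word n y \<Longrightarrow> g x = g y"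
  unfolding determined_by_def by blast

lemma finite_words: "finite (words (\<Omega> :: (int \<Rightarrow> 'a::finite) set) n)"
proof (rule finite_subset)
  show "words \<Omega> n \<subseteq> {xs. set xs \<subseteq> UNIV \<and> length xs = n}" by (auto simp: words_def)
qed (rule finite_lists_length_eq, simp)

lemma determined_by_finite_range:
  fixes \<Omega> :: "(int \<Rightarrow> 'a::finite) set"
  assumes "determined_by \<Omega> n g"
  shows "finite (g ` \<Omega>)"
proof (rule finite_subset)
  show "g ` \<Omega> \<subseteq> (\<lambda>w. g (SOME x. x \<in> \<Omega> \<and> prefix_word n x = w)) ` words \<Omega> n"
  proof
    fix v assume "v \<in> g ` \<Omega>"
    then obtain x where x: "x \<in> \<Omega>" "v = g x" by blast
    let ?y = "SOME y. y \<in> \<Omega> \<and> prefix_word n y = prefix_word n x"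
    have "?y \<in> \<Omega> \<and> prefix_word n ?y = prefix_word n x"
      using x by (intro someI[of "\<lambda>y. y \<in> \<Omega> \<and> prefix_word n y = prefix_word n x" x]) auto
    then have "v = g ?y" using determined_byD[OF assms x(1), of ?y] x by simp
    then show "v \<in> (\<lambda>w. g (SOME x. x \<in> \<Omega> \<and> prefix_word n x = w)) ` words \<Omega> n"
      using x(1) unfolding words_def by blast
  qed
  show "finite ((\<lambda>w. g (SOME x. x \<in> \<Omega> \<and> prefix_word n x = w)) ` words \<Omega> n)"
    by (rule finite_imageI) (rule finite_words)
qed

lemma open_coordinate: "open {\<omega> :: int \<Rightarrow> 'a::discrete_topology. \<omega> j = a}"
  using open_vimage[OF discrete_topology_class.open_discrete[of "{a}"] continuous_on_product_coordinates[of j]]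
  by (simp add: vimage_def)

lemma open_prefix_word: "open {\<omega> :: int \<Rightarrow> 'a::discrete_topology. prefix_word n \<omega> = w}"
proof (cases "length w = n")
  case True
  have eq: "{\<omega> :: int \<Rightarrow> 'a. prefix_word n \<omega> = w} = (\<Inter>i\<in>{..<n}. {\<omega>. \<omega> (1 + int i) = w ! i})"
  proof (rule set_eqI)
    fix \<omega> :: "int \<Rightarrow> 'a"
    have "prefix_word n \<omega> = w \<longleftrightarrow> (\<forall>i<n. prefix_word n \<omega> ! i = w ! i)"
      unfolding list_eq_iff_nth_eq using True by simp
    then show "\<omega> \<in> {\<omega>. prefix_word n \<omega> = w} \<longleftrightarrow> \<omega> \<in> (\<Inter>i\<in>{..<n}. {\<omega>. \<omega> (1 + int i) = w ! i})"
      by auto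
  qed
  show ?thesis unfolding eq by (rule open_INT) (use open_coordinate in blast)+
next
  case False
  then have "{\<omega> :: int \<Rightarrow> 'a. prefix_word n \<omega> = w} = {}" using length_prefix_word by blast
  then show ?thesis by (simp only: open_empty)
qed

lemma continuous_shift: "continuous_on UNIV (shift :: (int \<Rightarrow> 'a::topological_space) \<Rightarrow> _)"
  unfolding shift_def[abs_def]
  by (rule continuous_on_coordinatewise_then_product) (rule continuous_on_product_coordinates)

section \<open>Forcing many different words\<close>

text \<open>
A discrete intermediate value theorem: a sequence that climbs by steps of at most \<open>\<sigma>\<close> visits each of
the disjoint intervals \<open>(v + j\<sigma>, v + (j + 1)\<sigma>]\<close>.
\<close>

lemma visits_at_levels:
  fixes g :: "nat \<Rightarrow> real"
  assumes step: "\<And>s. g (Suc s) \<le> g s + \<sigma>" and "0 < \<sigma>"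
    and "a \<le> c" "g a \<le> v" "v + real q * \<sigma> < g c"
  obtains S where "finite S" "card S = q" "inj_on g S" "S \<subseteq> {a..c}"
    "\<And>s. s \<in> S \<Longrightarrow> v < g s \<and> g s \<le> v + real q * \<sigma>"
proof -
  have ivt: "\<exists>s\<in>{a..c}. v' < g s \<and> g s \<le> v' + \<sigma>" if v': "v \<le> v'" "v' < g c" for v'
  proof -
    define s where "s = (LEAST s. a \<le> s \<and> v' < g s)"
    have s: "a \<le> s" "v' < g s" "s \<le> c"
      using LeastI[of "\<lambda>s. a \<le> s \<and> v' < g s" c] Least_le[of "\<lambda>s. a \<le> s \<and> v' < g s" c] v' \<open>a \<le> c\<close>
      unfolding s_def by auto
    have "s \<noteq> a" using s v' \<open>g a \<le> v\<close> by auto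
    then obtain s' where s': "s = Suc s'" "a \<le> s'" using s by (cases s) auto
    have "g s' \<le> v'" using not_less_Least[of s' "\<lambda>s. a \<le> s \<and> v' < g s"] s' unfolding s_def by auto
    then show ?thesis using step[of s'] s s' by (intro bexI[of _ s]) auto
  qed
  have "\<exists>s\<in>{a..c}. v + real j * \<sigma> < g s \<and> g s \<le> v + real (Suc j) * \<sigma>" if "j < q" for j
  proof -
    have "real j * \<sigma> \<le> real q * \<sigma>" using that \<open>0 < \<sigma>\<close> by simp
    moreover have "v + real (Suc j) * \<sigma> = v + real j * \<sigma> + \<sigma>" by (simp add: algebra_simps)
    moreover have "0 \<le> real j * \<sigma>" using \<open>0 < \<sigma>\<close> by simp
    ultimately show ?thesis
      using ivt[of "v + real j * \<sigma>"] \<open>v + real q * \<sigma> < g c\<close> by auto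
  qed
  then obtain \<tau> where \<tau>: "\<And>j. j < q \<Longrightarrow> \<tau> j \<in> {a..c}"
    "\<And>j. j < q \<Longrightarrow> v + real j * \<sigma> < g (\<tau> j) \<and> g (\<tau> j) \<le> v + real (Suc j) * \<sigma>"
    by metis
  have neq: "g (\<tau> j) < g (\<tau> j')" if "j < j'" "j' < q" for j j'
  proof -
    have "real (Suc j) * \<sigma> \<le> real j' * \<sigma>" using that \<open>0 < \<sigma>\<close> by (intro mult_right_mono) auto
    then show ?thesis using \<tau>(2)[of j] \<tau>(2)[of j'] that by auto
  qed
  have inj: "inj_on (g \<circ> \<tau>) {..<q}"
    by (rule inj_onI) (metis comp_apply lessThan_iff linorder_neqE_nat neq order_less_irrefl)
  show thesis
  proof (rule that[of "\<tau> ` {..<q}"])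
    show "card (\<tau> ` {..<q}) = q" using inj_on_imageI2[OF inj] by (simp add: card_image)
    show "inj_on g (\<tau> ` {..<q})" using inj_on_imageI[OF inj] .
    show "\<tau> ` {..<q} \<subseteq> {a..c}" using \<tau>(1) by auto
    show "v < g s \<and> g s \<le> v + real q * \<sigma>" if s: "s \<in> \<tau> ` {..<q}" for s
    proof -
      obtain j where j: "j < q" "s = \<tau> j" using s by auto
      have "0 \<le> real j * \<sigma>" "real (Suc j) * \<sigma> \<le> real q * \<sigma>"
        using j \<open>0 < \<sigma>\<close> by (auto intro!: mult_right_mono)
      then show ?thesis using \<tau>(2)[of j] j by auto
    qed
  qed simp
qed

text \<open>
Here \<open>u\<close> is a sequence of letters and \<open>g t\<close> depends on the word of length \<open>L\<close> that starts at \<open>t\<close>.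

By the drift hypothesis the climb from \<open>b\<close> to \<open>b + 3\<delta>\<close> takes longer than \<open>2L\<close>. Take the last time \<open>s\<close> below
level \<open>b\<close>. Either the \<open>h\<close> words that start right after \<open>s\<close> are different, or one of them recurs after a
time \<open>p < h\<close>. In the second case \<open>u\<close> has period \<open>p\<close> on a stretch, during which \<open>g\<close> repeats values from
the first third of the band. As \<open>g\<close> leaves the band later, the stretch ends. The next \<open>h\<close> words contain
the place where the period \<open>p\<close> breaks. If two of them, at distance \<open>q < h\<close>, were equal, then a period
\<open>q\<close> around that place, together with the period \<open>p\<close> before it, would extend the period \<open>p\<close> beyond it;
three lengths less than \<open>h\<close> have to fit into \<open>L\<close> for this. These words also occur before \<open>g\<close> leaves the band, since
the drift during \<open>h\<close> steps is at most \<open>\<delta>\<close>.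
\<close>

lemma many_words_between_levels:
  fixes u :: "nat \<Rightarrow> 'a" and g :: "nat \<Rightarrow> real"
  assumes word: "\<And>s t. (\<And>i. i < L \<Longrightarrow> u (s + i) = u (t + i)) \<Longrightarrow> g s = g t"
    and drift: "\<And>s t. s \<le> t \<Longrightarrow> t \<le> s + L \<Longrightarrow> \<bar>g t - g s\<bar> \<le> \<delta>"
    and "0 < \<delta>" and ac: "a \<le> c" and ga: "g a \<le> b" and gc: "b + 3 * \<delta> \<le> g c" and "3 * h \<le> L"
  shows "\<exists>S. finite S \<and> card S = h \<and> (\<forall>t\<in>S. b < g t \<and> g t < b + 3 * \<delta>) \<and>
           (\<forall>s\<in>S. \<forall>t\<in>S. s \<noteq> t \<longrightarrow> (\<exists>i<L. u (s + i) \<noteq> u (t + i)))"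
proof -
  have witness: ?thesis
    if "finite S" "card S = h" "\<And>t. t \<in> S \<Longrightarrow> b < g t \<and> g t < b + 3 * \<delta>"
      "\<And>s t. s \<in> S \<Longrightarrow> t \<in> S \<Longrightarrow> s \<noteq> t \<Longrightarrow> \<exists>i<L. u (s + i) \<noteq> u (t + i)" for S
    using that by (intro exI[of _ S] conjI ballI impI) auto
  define c' where "c' = (LEAST t. a \<le> t \<and> b + 3 * \<delta> \<le> g t)"
  have c': "a \<le> c'" "b + 3 * \<delta> \<le> g c'"
    using LeastI[of "\<lambda>t. a \<le> t \<and> b + 3 * \<delta> \<le> g t" c] ac gc unfolding c'_def by auto
  have c'_least: "g t < b + 3 * \<delta>" if "a \<le> t" "t < c'" for t
    using not_less_Least[of t "\<lambda>t. a \<le> t \<and> b + 3 * \<delta> \<le> g t"] that unfolding c'_def by auto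
  define s where "s = (GREATEST t. t \<le> c' \<and> g t \<le> b)"
  have s: "s \<le> c'" "g s \<le> b"
    using GreatestI_nat[of "\<lambda>t. t \<le> c' \<and> g t \<le> b" a c'] c' ga unfolding s_def by auto
  have s_greatest: "t \<le> s" if "t \<le> c'" "g t \<le> b" for t
    using Greatest_le_nat[of "\<lambda>t. t \<le> c' \<and> g t \<le> b" t c'] that unfolding s_def by auto
  have as: "a \<le> s" using s_greatest[of a] c' ga by simp
  have between: "b < g t \<and> g t < b + 3 * \<delta>" if "s < t" "t < c'" for t
    using s_greatest[of t] c'_least[of t] that as by force
  have near1: "g t \<le> b + \<delta>" if "s \<le> t" "t \<le> s + L" for t using drift[OF that] s by linarith
  have near2: "g t \<le> b + 2 * \<delta>" if "s \<le> t" "t \<le> s + 2 * L" for t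
  proof (cases "t \<le> s + L")
    case True then show ?thesis using near1[of t] that \<open>0 < \<delta>\<close> by simp
  next
    case False
    then show ?thesis using near1[of "s + L"] drift[of "s + L" t] that by simp
  qed
  have far: "s + 2 * L < c'"
  proof (rule ccontr)
    assume "\<not> ?thesis"
    then have "g c' \<le> b + 2 * \<delta>" using near2[of c'] s by simp
    then show False using c' \<open>0 < \<delta>\<close> by linarith
  qed
  define W where "W s t \<longleftrightarrow> (\<forall>i<L. u (s + i) = u (t + i))" for s t
  have gW: "g s = g t" if "W s t" for s t using word that unfolding W_def by blast
  show ?thesis
  proof (cases "\<exists>r\<in>{s+1..s+h}. \<exists>r'\<in>{s+1..s+h}. r < r' \<and> W r r'")
    case False
    show ?thesis
    proof (rule witness[of "{s+1..s+h}"])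
      show "b < g t \<and> g t < b + 3 * \<delta>" if "t \<in> {s+1..s+h}" for t
        using between[of t] far that \<open>3 * h \<le> L\<close> by simp
      show "\<exists>i<L. u (x + i) \<noteq> u (y + i)" if "x \<in> {s+1..s+h}" "y \<in> {s+1..s+h}" "x \<noteq> y" for x y
        using False that unfolding W_def by (metis linorder_neqE_nat)
    qed auto
  next
    case True
    then obtain r r' where r: "s < r" "r < r'" "r' \<le> s + h" "W r r'" by (auto simp: Suc_le_eq)
    define p where "p = r' - r"
    have p: "0 < p" "p < h" "r' = r + p" using r by (auto simp: p_def)
    have run: "g t \<le> b + \<delta>" if Q: "\<And>t. r \<le> t \<Longrightarrow> t < e \<Longrightarrow> W t (t + p)" and "r \<le> t" "t < e + p" for t e
      using that(2,3)
    proof (induction t rule: less_induct)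
      case (less t)
      show ?case
      proof (cases "t < r + p")
        case True
        then show ?thesis using less.prems near1[of t] r p \<open>3 * h \<le> L\<close> by simp
      next
        case False
        then have "W (t - p) t" using Q[of "t - p"] less.prems by auto
        then have "g t = g (t - p)" using gW by metis
        then show ?thesis using less.IH[of "t - p"] False less.prems p by auto
      qed
    qed
    have "\<exists>t\<ge>r. \<not> W t (t + p)"
    proof (rule ccontr)
      assume "\<not> ?thesis"
      then have "g c' \<le> b + \<delta>"
        using far r \<open>3 * h \<le> L\<close> by (intro run[of "c' + 1"]) auto
      then show False using c' \<open>0 < \<delta>\<close> by linarith
    qed
    define e where "e = (LEAST t. r \<le> t \<and> \<not> W t (t + p))"
    from \<open>\<exists>t\<ge>r. \<not> W t (t + p)\<close> obtain t0 where t0: "r \<le> t0 \<and> \<not> W t0 (t0 + p)" by blast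
    have "r \<le> e \<and> \<not> W e (e + p)"
      unfolding e_def using t0 by (rule LeastI[of "\<lambda>t. r \<le> t \<and> \<not> W t (t + p)"])
    then have e: "r \<le> e" "\<not> W e (e + p)" by blast+
    have Q: "W t (t + p)" if "r \<le> t" "t < e" for t
      using not_less_Least[of t "\<lambda>t. r \<le> t \<and> \<not> W t (t + p)"] that unfolding e_def by blast
    have re: "r < e" using e r(4) p(3) by (metis le_neq_implies_less)
    have late: "g t \<le> b + 2 * \<delta>" if "r \<le> t" "t < e + p + h" for t
    proof (cases "t < e + p")
      case True
      then show ?thesis using run[OF Q that(1)] \<open>0 < \<delta>\<close> by fastforce
    next
      case False
      then have "\<bar>g t - g (e + p - 1)\<bar> \<le> \<delta>" using that p \<open>3 * h \<le> L\<close> by (intro drift) auto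
      moreover have "g (e + p - 1) \<le> b + \<delta>" using p re by (intro run[OF Q]) auto
      ultimately show ?thesis by linarith
    qed
    have c'_late: "e + p + h \<le> c'"
    proof (rule ccontr)
      assume "\<not> ?thesis"
      then have "g c' \<le> b + 2 * \<delta>" using late[of c'] far r \<open>3 * h \<le> L\<close> by simp
      then show False using c' \<open>0 < \<delta>\<close> by linarith
    qed
    have L0: "0 < L" using p \<open>3 * h \<le> L\<close> by simp
    have period: "u j = u (j + p)" if "r \<le> j" "j < e + L - 1" for j
    proof (cases "j < e")
      case True
      then show ?thesis using Q[of j] that p \<open>3 * h \<le> L\<close> unfolding W_def by (metis add.right_neutral L0)
    next
      case False
      have "W (e - 1) (e - 1 + p)" by (rule Q) (use re in auto)
      moreover have "j - (e - 1) < L" using that False by auto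
      ultimately have "u (e - 1 + (j - (e - 1))) = u (e - 1 + p + (j - (e - 1)))"
        unfolding W_def by blast
      moreover have "e - 1 + (j - (e - 1)) = j" "e - 1 + p + (j - (e - 1)) = j + p" using False re by auto
      ultimately show ?thesis by (simp only:)
    qed
    \<comment> \<open>The words at \<open>e - 1\<close> and \<open>e - 1 + p\<close> agree, so those at \<open>e\<close> and \<open>e + p\<close> can only differ in their last letter.\<close>
    have break_neq: "u (e + L - 1) \<noteq> u (e + L - 1 + p)"
    proof
      assume eq: "u (e + L - 1) = u (e + L - 1 + p)"
      have "u (e + i) = u (e + p + i)" if "i < L" for i
      proof (cases "i = L - 1")
        case True then show ?thesis using eq L0 by (simp add: add.commute add.left_commute)
      next
        case False
        then show ?thesis using period[of "e + i"] that re by (simp add: add.commute add.left_commute)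
      qed
      with e show False unfolding W_def by blast
    qed
    have distinct: "\<not> W x y" if "e + p \<le> x" "x < y" "y < e + p + h" for x y
    proof
      assume "W x y"
      define q \<rho> where "q = y - x" and "\<rho> = x - (e + p)"
      have y: "y = x + q" and x: "x = e + p + \<rho>" and q: "0 < q" and small: "q + \<rho> < h"
        using that by (auto simp: q_def \<rho>_def)
      have W: "u (x + i) = u (x + q + i)" if "i < L" for i using \<open>W x y\<close> that unfolding W_def y by blast
      have bound: "p + q + \<rho> + 1 \<le> L" using small p \<open>3 * h \<le> L\<close> by simp
      have "u (e + L - 1 + p) = u (e + L - 1 + p - q)"
        using W[of "L - 1 - q - \<rho>"] bound by (simp add: x algebra_simps)
      also have "\<dots> = u (e + L - 1 - q)"
        using period[of "e + L - 1 - q"] bound re q by (simp add: algebra_simps)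
      also have "\<dots> = u (e + L - 1)"
        using W[of "L - 1 - q - \<rho> - p"] bound by (simp add: x algebra_simps)
      finally show False using break_neq by simp
    qed
    show ?thesis
    proof (rule witness[of "{e+p..<e+p+h}"])
      show "b < g t \<and> g t < b + 3 * \<delta>" if "t \<in> {e+p..<e+p+h}" for t
        using between[of t] c'_late re r that by simp
      show "\<exists>i<L. u (x + i) \<noteq> u (y + i)" if "x \<in> {e+p..<e+p+h}" "y \<in> {e+p..<e+p+h}" "x \<noteq> y" for x y
        using that distinct[of x y] distinct[of y x] unfolding W_def by (metis atLeastLessThan_iff linorder_neqE_nat)
    qed auto
  qed
qed

section \<open>Words of uniformly large measure\<close>

text \<open>
An invariant measure for which all words of one fixed length \<open>N\<close> have measure at least \<open>c\<close>. For \<open>c = 0\<close> this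
is any invariant measure.
\<close>

locale word_frequency = prob_space \<mu> for \<mu> :: "(int \<Rightarrow> 'a::{finite, discrete_topology}) measure" +
  fixes \<Omega> :: "(int \<Rightarrow> 'a) set" and N :: nat and c :: real
  assumes inv: "invariant_prob \<Omega> \<mu>"
    and shift_in: "\<omega> \<in> \<Omega> \<Longrightarrow> shift \<omega> \<in> \<Omega>"
    and mass: "w \<in> words \<Omega> N \<Longrightarrow> c \<le> measure \<mu> (cylinder \<Omega> w)"
begin

lemma sets_\<mu>: "sets \<mu> = sets (restrict_space borel \<Omega>)"
  using inv by (simp add: invariant_prob_def)

lemma space_\<mu> [simp]: "space \<mu> = \<Omega>"
  using sets_eq_imp_space_eq[OF sets_\<mu>] by (simp add: space_restrict_space)

lemma cylinder_sets: "cylinder \<Omega> w \<in> sets \<mu>"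
proof -
  have "cylinder \<Omega> w = \<Omega> \<inter> {\<omega>. prefix_word (length w) \<omega> = w}" by (auto simp: cylinder_def)
  then show ?thesis
    unfolding sets_\<mu> sets_restrict_space using borel_open[OF open_prefix_word] by auto
qed

lemma determined_sets:
  assumes "determined_by \<Omega> n P"
  shows "{x \<in> \<Omega>. P x} \<in> sets \<mu>"
proof -
  have "{x \<in> \<Omega>. P x} = (\<Union>w \<in> words {x \<in> \<Omega>. P x} n. cylinder \<Omega> w)"
  proof (intro subset_antisym subsetI)
    fix x assume "x \<in> (\<Union>w \<in> words {x \<in> \<Omega>. P x} n. cylinder \<Omega> w)"
    then obtain y where "y \<in> \<Omega>" "P y" "x \<in> \<Omega>" "prefix_word n x = prefix_word n y"
      by (auto simp: words_def cylinder_def)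
    then show "x \<in> {x \<in> \<Omega>. P x}" using determined_byD[OF assms, of x y] by simp
  qed (auto simp: words_def cylinder_def)
  also have "\<dots> \<in> sets \<mu>"
    using cylinder_sets finite_words by (intro sets.finite_UN) auto
  finally show ?thesis .
qed

lemma determined_measurable:
  fixes g :: "(int \<Rightarrow> 'a) \<Rightarrow> real"
  assumes "determined_by \<Omega> n g"
  shows "g \<in> borel_measurable \<mu>"
proof (rule measurableI)
  fix B :: "real set" assume "B \<in> sets borel"
  have "determined_by \<Omega> n (\<lambda>x. g x \<in> B)" using assms unfolding determined_by_def by metis
  from determined_sets[OF this] show "g -` B \<inter> space \<mu> \<in> sets \<mu>"
    by (simp add: vimage_def Int_def conj_commute)
qed simp

lemma determined_integrable:
  fixes g :: "(int \<Rightarrow> 'a) \<Rightarrow> real"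
  assumes "determined_by \<Omega> n g"
  shows "integrable \<mu> g"
proof -
  obtain B where "\<And>y. y \<in> g ` \<Omega> \<Longrightarrow> norm y \<le> B"
    using finite_imp_bounded[OF determined_by_finite_range[OF assms]] by (auto simp: bounded_iff)
  then show ?thesis
    using determined_measurable[OF assms] by (intro integrable_const_bound[of _ B]) (auto intro!: AE_I2)
qed

lemma shift_measurable: "shift \<in> measurable \<mu> \<mu>"
proof -
  have "shift \<in> measurable borel (borel :: (int \<Rightarrow> 'a) measure)"
    by (rule borel_measurable_continuous_onI[OF continuous_shift])
  then have "shift \<in> measurable (restrict_space borel \<Omega>) (restrict_space borel \<Omega>)"
    using shift_in by (intro measurable_restrict_space3) auto
  then show ?thesis using measurable_cong_sets[OF sets_\<mu> sets_\<mu>] by blast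
qed

lemma distr_shift: "distr \<mu> \<mu> shift = \<mu>"
proof (rule measure_eqI)
  fix B assume "B \<in> sets (distr \<mu> \<mu> shift)"
  then show "emeasure (distr \<mu> \<mu> shift) B = emeasure \<mu> B"
    using inv by (simp add: emeasure_distr[OF shift_measurable] invariant_prob_def)
qed simp

lemma funpow_shift_in: "\<omega> \<in> \<Omega> \<Longrightarrow> (shift ^^ n) \<omega> \<in> \<Omega>"
  by (rule funpow_shift_closed[OF shift_in])

lemma determined_by_funpow_shift:
  assumes "determined_by \<Omega> k g" "k + i \<le> n"
  shows "determined_by \<Omega> n (\<lambda>x. g ((shift ^^ i) x))"
  unfolding determined_by_def
  using determined_byD[OF assms(1) funpow_shift_in funpow_shift_in] prefix_word_funpow_shift[OF _ assms(2)]
  by blast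

text \<open>
Different words give disjoint cylinders, and each of them has measure at least \<open>c\<close>.
\<close>

lemma card_words_le_measure:
  assumes "finite X" "X \<subseteq> {x \<in> \<Omega>. P x}" "inj_on (prefix_word N) X" "determined_by \<Omega> N P"
  shows "real (card X) * c \<le> measure \<mu> {x \<in> \<Omega>. P x}"
proof -
  have "real (card X) * c = (\<Sum>x\<in>X. c)" by simp
  also have "\<dots> \<le> (\<Sum>x\<in>X. measure \<mu> (cylinder \<Omega> (prefix_word N x)))"
    using assms(2) by (intro sum_mono mass) (auto simp: words_def)
  also have "\<dots> = measure \<mu> (\<Union>x\<in>X. cylinder \<Omega> (prefix_word N x))"
  proof (rule finite_measure_finite_Union[symmetric])
    show "disjoint_family_on (\<lambda>x. cylinder \<Omega> (prefix_word N x)) X"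
      using assms(3) unfolding disjoint_family_on_def by (auto simp: cylinder_def inj_on_def)
  qed (use assms cylinder_sets in auto)
  also have "\<dots> \<le> measure \<mu> {x \<in> \<Omega>. P x}"
  proof (rule finite_measure_mono)
    show "(\<Union>x\<in>X. cylinder \<Omega> (prefix_word N x)) \<subseteq> {x \<in> \<Omega>. P x}"
    proof
      fix y assume "y \<in> (\<Union>x\<in>X. cylinder \<Omega> (prefix_word N x))"
      then obtain x where "x \<in> X" "y \<in> \<Omega>" "prefix_word N y = prefix_word N x"
        by (auto simp: cylinder_def)
      then show "y \<in> {x \<in> \<Omega>. P x}" using assms(2) determined_byD[OF assms(4), of y x] by auto
    qed
  qed (rule determined_sets[OF assms(4)])
  finally show ?thesis .
qed

text \<open>
Suppose that \<open>f\<close> changes by more than \<open>\<delta>\<close> within \<open>L\<close> steps. Then there are \<open>q\<close> times \<open>S1\<close> at which \<open>f\<close> lies in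
the first quarter of this range, at different values, and \<open>q\<close> later times \<open>S2\<close> at which it lies in the last
quarter. The points of the orbit at the times \<open>S1\<close> have different words, and at each of them the sum \<open>\<Phi>\<close> of the squares of
\<open>f \<circ> T\<^sup>i - f\<close> over \<open>i \<le> L\<close> is at least \<open>q (\<delta>/2)\<^sup>2\<close>. Since \<open>\<Phi>\<close> is determined by words of length \<open>N\<close>, it is that
large on a set of measure at least \<open>q c\<close>, which is more than its integral allows.
\<close>

lemma small_drift:
  fixes f :: "(int \<Rightarrow> 'a) \<Rightarrow> real"
  assumes det: "determined_by \<Omega> L f" and LN: "2 * L \<le> N"
    and slow: "\<And>x. x \<in> \<Omega> \<Longrightarrow> \<bar>f (shift x) - f x\<bar> \<le> \<sigma>" and "0 < \<sigma>" "0 < q" "real q * \<sigma> \<le> \<delta> / 4"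
    and almost_inv: "\<And>i. (\<integral>x. (f ((shift ^^ i) x) - f x)\<^sup>2 \<partial>\<mu>) \<le> \<eta>"
    and small: "real (L + 1) * \<eta> < real q * c * (real q * (\<delta> / 2)\<^sup>2)"
    and x: "x \<in> \<Omega>" and t: "t \<le> L"
  shows "\<bar>f ((shift ^^ t) x) - f x\<bar> \<le> \<delta>"
proof (rule ccontr)
  assume "\<not> ?thesis"
  then obtain \<kappa> :: real where \<kappa>: "\<kappa> = 1 \<or> \<kappa> = -1" "\<delta> < \<kappa> * (f ((shift ^^ t) x) - f x)"
    by (metis abs_if mult.commute mult_1 mult_minus1 not_le)
  define g where "g s = \<kappa> * (f ((shift ^^ s) x) - f x)" for s
  have g0: "g 0 = 0" and gt: "\<delta> < g t" using \<kappa> by (simp_all add: g_def)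
  have g_diff: "(g s' - g s)\<^sup>2 = (f ((shift ^^ s') x) - f ((shift ^^ s) x))\<^sup>2" for s s'
    using \<kappa>(1) by (auto simp: g_def power2_eq_square algebra_simps)
  have step: "g (Suc s) \<le> g s + \<sigma>" for s
    using slow[OF funpow_shift_in[OF x, of s]] \<kappa>(1) by (auto simp: g_def)
  have "\<sigma> \<le> real q * \<sigma>" using \<open>0 < q\<close> \<open>0 < \<sigma>\<close> by simp
  then have \<sigma>\<delta>: "\<sigma> \<le> \<delta> / 4" and \<delta>0: "0 < \<delta>" using assms(4-6) by linarith+
  \<comment> \<open>Splitting at the first passage through the middle makes all times of \<open>S1\<close> precede those of \<open>S2\<close>.\<close>
  define s1 where "s1 = (LEAST s. \<delta> / 2 < g s)"
  have s1: "\<delta> / 2 < g s1" "s1 \<le> t"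
    using LeastI[of "\<lambda>s. \<delta> / 2 < g s" t] Least_le[of "\<lambda>s. \<delta> / 2 < g s" t] gt \<delta>0 unfolding s1_def by auto
  have "s1 \<noteq> 0" using s1 g0 \<delta>0 by (metis half_gt_zero_iff order_less_asym)
  then obtain s0 where s0: "s1 = Suc s0" by (cases s1) auto
  have "g s0 \<le> \<delta> / 2" using not_less_Least[of s0 "\<lambda>s. \<delta> / 2 < g s"] s0 unfolding s1_def by auto
  then have g_s1: "g s1 \<le> 3 * \<delta> / 4" using step[of s0] s0 \<sigma>\<delta> by simp
  obtain S1 where S1: "finite S1" "card S1 = q" "inj_on g S1" "S1 \<subseteq> {0..s1}"
    "\<And>s. s \<in> S1 \<Longrightarrow> 0 < g s \<and> g s \<le> 0 + real q * \<sigma>"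
  proof (rule visits_at_levels[of g \<sigma> 0 s1 0 q])
    show "0 + real q * \<sigma> < g s1" using assms(6) s1(1) \<delta>0 by linarith
  qed (use step \<open>0 < \<sigma>\<close> g0 in simp_all)
  obtain S2 where S2: "finite S2" "card S2 = q" "inj_on g S2" "S2 \<subseteq> {s1..t}"
    "\<And>s. s \<in> S2 \<Longrightarrow> 3 * \<delta> / 4 < g s"
  proof (rule visits_at_levels[of g \<sigma> s1 t "3 * \<delta> / 4" q])
    show "3 * \<delta> / 4 + real q * \<sigma> < g t" using assms(6) gt by linarith
  qed (use step \<open>0 < \<sigma>\<close> g_s1 s1(2) in simp_all)
  define \<Phi> where "\<Phi> y = (\<Sum>i\<le>L. (f ((shift ^^ i) y) - f y)\<^sup>2)" for y
  have f_det: "determined_by \<Omega> N (\<lambda>y. f ((shift ^^ i) y))" if "i \<le> L" for i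
    using that LN by (intro determined_by_funpow_shift[OF det]) auto
  have term_det: "determined_by \<Omega> N (\<lambda>y. (f ((shift ^^ i) y) - f y)\<^sup>2)" if "i \<le> L" for i
    using f_det[OF that] f_det[of 0] unfolding determined_by_def funpow_0 id_apply by (metis le0)
  have \<Phi>_det: "determined_by \<Omega> N \<Phi>"
    unfolding determined_by_def \<Phi>_def
    by (intro ballI impI sum.cong refl determined_byD[OF term_det]) auto
  have \<Phi>_large: "real q * (\<delta> / 2)\<^sup>2 \<le> \<Phi> ((shift ^^ s) x)" if s: "s \<in> S1" for s
  proof -
    have le: "s \<le> s'" if "s' \<in> S2" for s' using s that S1(4) S2(4) by fastforce
    have "real q * (\<delta> / 2)\<^sup>2 = (\<Sum>s'\<in>S2. (\<delta> / 2)\<^sup>2)" by (simp add: S2)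
    also have "\<dots> \<le> (\<Sum>s'\<in>S2. (g s' - g s)\<^sup>2)"
    proof (rule sum_mono)
      fix s' assume "s' \<in> S2"
      then have "\<delta> / 2 \<le> g s' - g s" using S1(5)[OF s] S2(5) assms(6) by fastforce
      then show "(\<delta> / 2)\<^sup>2 \<le> (g s' - g s)\<^sup>2" using \<delta>0 by (intro power_mono) auto
    qed
    also have "\<dots> = (\<Sum>s'\<in>S2. (f ((shift ^^ (s' - s)) ((shift ^^ s) x)) - f ((shift ^^ s) x))\<^sup>2)"
    proof (rule sum.cong[OF refl])
      fix s' assume "s' \<in> S2"
      then have "(shift ^^ (s' - s)) ((shift ^^ s) x) = (shift ^^ s') x"
        using le by (metis comp_apply funpow_add le_add_diff_inverse2)
      then show "(g s' - g s)\<^sup>2 = (f ((shift ^^ (s' - s)) ((shift ^^ s) x)) - f ((shift ^^ s) x))\<^sup>2"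
        by (simp add: g_diff)
    qed
    also have "\<dots> = (\<Sum>i\<in>(\<lambda>s'. s' - s) ` S2. (f ((shift ^^ i) ((shift ^^ s) x)) - f ((shift ^^ s) x))\<^sup>2)"
      using le by (subst sum.reindex) (auto simp: inj_on_def eq_diff_iff)
    also have "\<dots> \<le> \<Phi> ((shift ^^ s) x)"
      unfolding \<Phi>_def
    proof (rule sum_mono2)
      show "(\<lambda>s'. s' - s) ` S2 \<subseteq> {..L}"
      proof (rule image_subsetI)
        fix s' assume "s' \<in> S2"
        then have "s' \<le> t" using S2(4) by auto
        then show "s' - s \<in> {..L}" using t by simp
      qed
    qed auto
    finally show ?thesis .
  qed
  define X where "X = (\<lambda>s. (shift ^^ s) x) ` S1"
  have f_X: "f ((shift ^^ s) x) \<noteq> f ((shift ^^ s') x)" if "s \<in> S1" "s' \<in> S1" "s \<noteq> s'" for s s'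
    using inj_onD[OF S1(3) _ that(1,2)] that(3) by (auto simp: g_def)
  have inj_X: "inj_on (\<lambda>s. (shift ^^ s) x) S1" by (rule inj_onI) (metis f_X)
  have "inj_on (prefix_word N) X"
  proof (rule inj_onI)
    fix y y' assume y: "y \<in> X" "y' \<in> X" and eq: "prefix_word N y = prefix_word N y'"
    have "prefix_word L y = prefix_word L y'" using eq by (rule prefix_word_mono) (use LN in simp)
    moreover have "y \<in> \<Omega>" "y' \<in> \<Omega>" using y funpow_shift_in[OF x] by (auto simp: X_def)
    ultimately have "f y = f y'" by (intro determined_byD[OF det])
    then show "y = y'" using y f_X unfolding X_def by blast
  qed
  moreover have "determined_by \<Omega> N (\<lambda>y. real q * (\<delta> / 2)\<^sup>2 \<le> \<Phi> y)"
    using \<Phi>_det unfolding determined_by_def by metis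
  moreover have "X \<subseteq> {y \<in> \<Omega>. real q * (\<delta> / 2)\<^sup>2 \<le> \<Phi> y}"
    using \<Phi>_large funpow_shift_in[OF x] by (auto simp: X_def)
  ultimately have "real (card X) * c \<le> measure \<mu> {y \<in> \<Omega>. real q * (\<delta> / 2)\<^sup>2 \<le> \<Phi> y}"
    using S1(1) by (intro card_words_le_measure) (auto simp: X_def)
  moreover have "card X = q" using card_image[OF inj_X] S1 by (simp add: X_def)
  moreover have "measure \<mu> {y \<in> space \<mu>. real q * (\<delta> / 2)\<^sup>2 \<le> \<Phi> y} \<le> (\<integral>y. \<Phi> y \<partial>\<mu>) / (real q * (\<delta> / 2)\<^sup>2)"
  proof (rule integral_Markov_inequality_measure[where A = "{}"])
    show "integrable \<mu> \<Phi>" by (rule determined_integrable[OF \<Phi>_det])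
    show "AE y in \<mu>. 0 \<le> \<Phi> y" by (simp add: \<Phi>_def sum_nonneg)
    show "0 < real q * (\<delta> / 2)\<^sup>2" using \<delta>0 \<open>0 < q\<close> by simp
  qed simp
  ultimately have "real q * c \<le> (\<integral>y. \<Phi> y \<partial>\<mu>) / (real q * (\<delta> / 2)\<^sup>2)" by simp
  then have "real q * c * (real q * (\<delta> / 2)\<^sup>2) \<le> (\<integral>y. \<Phi> y \<partial>\<mu>)"
    using \<delta>0 \<open>0 < q\<close> by (simp add: pos_le_divide_eq)
  also have "\<dots> = (\<Sum>i\<le>L. \<integral>y. (f ((shift ^^ i) y) - f y)\<^sup>2 \<partial>\<mu>)"
    unfolding \<Phi>_def by (intro Bochner_Integration.integral_sum determined_integrable[OF term_det]) auto
  also have "\<dots> \<le> (\<Sum>i\<le>L. \<eta>)" by (intro sum_mono almost_inv)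
  finally show False using small by simp
qed

end

text \<open>
The orbits of minimality are two-sided, so that the word of \<open>y\<close> may occur before or after that of \<open>x\<close>.
\<close>

lemma minimal_subshift_transition:
  fixes \<Omega> :: "(int \<Rightarrow> 'a::{finite, discrete_topology}) set"
  assumes "minimal_subshift \<Omega>" "x \<in> \<Omega>" "y \<in> \<Omega>"
  obtains z p where "z \<in> \<Omega>" "prefix_word n z = prefix_word n x" "prefix_word n ((shift ^^ p) z) = prefix_word n y"
  | z p where "z \<in> \<Omega>" "prefix_word n z = prefix_word n y" "prefix_word n ((shift ^^ p) z) = prefix_word n x"
proof -
  have sub: "shift ` \<Omega> = \<Omega>" and "y \<in> closure (orbit x)"
    using assms unfolding minimal_subshift_def subshift_def by auto
  then have "{\<omega>. prefix_word n \<omega> = prefix_word n y} \<inter> orbit x \<noteq> {}"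
    using open_Int_closure_eq_empty[OF open_prefix_word, of n "prefix_word n y" "orbit x"] by blast
  then obtain k :: int where k: "prefix_word n (\<lambda>i. x (i + k)) = prefix_word n y"
    unfolding orbit_def by auto
  show thesis
  proof (cases "0 \<le> k")
    case True
    then have "(shift ^^ nat k) x = (\<lambda>i. x (i + k))" by (auto simp: funpow_shift_apply)
    then show ?thesis using k assms(2) that(1)[of x "nat k"] by simp
  next
    case False
    have "(shift ^^ nat (- k)) ` \<Omega> = \<Omega>" using sub by (rule funpow_shift_image)
    then obtain z where z: "z \<in> \<Omega>" "x = (shift ^^ nat (- k)) z" using assms(2) by (metis imageE)
    have "z = (\<lambda>i. x (i + k))" using False by (auto simp: z funpow_shift_apply)
    then show ?thesis using k z that(2)[of z "nat (- k)"] by simp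
  qed
qed

context word_frequency begin

text \<open>
Cut the range between \<open>f x\<close> and \<open>f y\<close> into \<open>r\<close> bands of width \<open>3\<delta>\<close>. A word that leads from one end of the range
to the other forces at least \<open>L div 3\<close> different words in each band, so each band has measure at least
\<open>(L div 3) c\<close>. For large \<open>r\<close> the total measure exceeds one. If the orbit descends instead of climbing,
the same argument applies to \<open>- f\<close>.
\<close>

lemma small_oscillation:
  fixes f :: "(int \<Rightarrow> 'a) \<Rightarrow> real"
  assumes "minimal_subshift \<Omega>" and det: "determined_by \<Omega> L f" and LN: "L \<le> N"
    and drift: "\<And>x t. x \<in> \<Omega> \<Longrightarrow> t \<le> L \<Longrightarrow> \<bar>f ((shift ^^ t) x) - f x\<bar> \<le> \<delta>" and "0 < \<delta>"
    and "1 < real r * (real (L div 3) * c)"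
    and x: "x \<in> \<Omega>" and y: "y \<in> \<Omega>"
  shows "f y - f x < 3 * \<delta> * real r"
proof (rule ccontr)
  assume big: "\<not> ?thesis"
  define h where "h = L div 3"
  define b where "b j = f x + 3 * \<delta> * real j" for j :: nat
  have b_le: "f x \<le> b j" "b j + 3 * \<delta> \<le> f y" if "j < r" for j
  proof -
    have "3 * \<delta> * real (Suc j) \<le> 3 * \<delta> * real r" using that \<open>0 < \<delta>\<close> by (intro mult_left_mono) auto
    then show "b j + 3 * \<delta> \<le> f y" using big by (simp add: b_def algebra_simps)
    show "f x \<le> b j" using \<open>0 < \<delta>\<close> by (simp add: b_def)
  qed
  define B where "B j = {w \<in> \<Omega>. b j < f w \<and> f w < b j + 3 * \<delta>}" for j
  have B_det: "determined_by \<Omega> N (\<lambda>w. b j < f w \<and> f w < b j + 3 * \<delta>)" for j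
    using det prefix_word_mono[OF _ LN] unfolding determined_by_def by metis
  have mass_B: "real h * c \<le> measure \<mu> (B j)" if j: "j < r" for j
  proof -
    have word: "f ((shift ^^ s) z) = f ((shift ^^ t) z)"
      if "z \<in> \<Omega>" "\<And>i. i < L \<Longrightarrow> z (1 + int (s + i)) = z (1 + int (t + i))" for z s t
    proof (rule determined_byD[OF det funpow_shift_in funpow_shift_in])
      show "prefix_word L ((shift ^^ s) z) = prefix_word L ((shift ^^ t) z)"
        using that(2) by (simp add: prefix_word_eq_iff funpow_shift_apply algebra_simps)
    qed (use that in auto)
    have drift': "\<bar>f ((shift ^^ t) z) - f ((shift ^^ s) z)\<bar> \<le> \<delta>" if "z \<in> \<Omega>" "s \<le> t" "t \<le> s + L" for z s t
    proof -
      have "(shift ^^ (t - s)) ((shift ^^ s) z) = (shift ^^ t) z"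
        using that by (metis comp_apply funpow_add le_add_diff_inverse2)
      then show ?thesis using drift[OF funpow_shift_in[OF that(1)], of "t - s" s] that by simp
    qed
    have "\<exists>z S. z \<in> \<Omega> \<and> finite S \<and> card S = h \<and> (\<forall>t\<in>S. b j < f ((shift ^^ t) z) \<and> f ((shift ^^ t) z) < b j + 3 * \<delta>)
        \<and> (\<forall>s\<in>S. \<forall>t\<in>S. s \<noteq> t \<longrightarrow> (\<exists>i<L. z (1 + int (s + i)) \<noteq> z (1 + int (t + i))))"
    proof (rule minimal_subshift_transition[OF assms(1) x y, of L])
      fix z p assume z: "z \<in> \<Omega>" "prefix_word L z = prefix_word L x"
        "prefix_word L ((shift ^^ p) z) = prefix_word L y"
      have fz: "f z = f x" "f ((shift ^^ p) z) = f y"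
        using determined_byD[OF det] z x y funpow_shift_in by blast+
      have "\<exists>S. finite S \<and> card S = h \<and> (\<forall>t\<in>S. b j < f ((shift ^^ t) z) \<and> f ((shift ^^ t) z) < b j + 3 * \<delta>)
        \<and> (\<forall>s\<in>S. \<forall>t\<in>S. s \<noteq> t \<longrightarrow> (\<exists>i<L. z (1 + int (s + i)) \<noteq> z (1 + int (t + i))))"
      proof (rule many_words_between_levels[where u = "\<lambda>k. z (1 + int k)" and L = L and \<delta> = \<delta>
            and g = "\<lambda>t. f ((shift ^^ t) z)" and a = 0 and c = p and b = "b j" and h = h])
        show "f ((shift ^^ 0) z) \<le> b j" "b j + 3 * \<delta> \<le> f ((shift ^^ p) z)"
          using b_le[OF j] fz by simp_all
        show "f ((shift ^^ s) z) = f ((shift ^^ t) z)"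
          if "\<And>i. i < L \<Longrightarrow> z (1 + int (s + i)) = z (1 + int (t + i))" for s t
          by (rule word[OF z(1) that])
        show "\<bar>f ((shift ^^ t) z) - f ((shift ^^ s) z)\<bar> \<le> \<delta>" if "s \<le> t" "t \<le> s + L" for s t
          by (rule drift'[OF z(1) that])
        show "0 \<le> p" "3 * h \<le> L" "0 < \<delta>" using \<open>0 < \<delta>\<close> by (simp_all add: h_def)
      qed
      then show ?thesis using z(1) by blast
    next
      fix z p assume z: "z \<in> \<Omega>" "prefix_word L z = prefix_word L y"
        "prefix_word L ((shift ^^ p) z) = prefix_word L x"
      have fz: "f z = f y" "f ((shift ^^ p) z) = f x"
        using determined_byD[OF det] z x y funpow_shift_in by blast+
      have "\<exists>S. finite S \<and> card S = h \<and> (\<forall>t\<in>S. - (b j + 3 * \<delta>) < - f ((shift ^^ t) z)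
            \<and> - f ((shift ^^ t) z) < - (b j + 3 * \<delta>) + 3 * \<delta>)
        \<and> (\<forall>s\<in>S. \<forall>t\<in>S. s \<noteq> t \<longrightarrow> (\<exists>i<L. z (1 + int (s + i)) \<noteq> z (1 + int (t + i))))"
      proof (rule many_words_between_levels[where u = "\<lambda>k. z (1 + int k)" and L = L and \<delta> = \<delta>
            and g = "\<lambda>t. - f ((shift ^^ t) z)" and a = 0 and c = p and b = "- (b j + 3 * \<delta>)" and h = h])
        show "- f ((shift ^^ 0) z) \<le> - (b j + 3 * \<delta>)" "- (b j + 3 * \<delta>) + 3 * \<delta> \<le> - f ((shift ^^ p) z)"
          using b_le[OF j] fz by simp_all
        show "\<bar>- f ((shift ^^ t) z) - - f ((shift ^^ s) z)\<bar> \<le> \<delta>" if "s \<le> t" "t \<le> s + L" for s t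
          using drift'[OF z(1) that] by linarith
        show "- f ((shift ^^ s) z) = - f ((shift ^^ t) z)"
          if "\<And>i. i < L \<Longrightarrow> z (1 + int (s + i)) = z (1 + int (t + i))" for s t
          using word[OF z(1) that] by (rule arg_cong)
        show "0 \<le> p" "3 * h \<le> L" "0 < \<delta>" using \<open>0 < \<delta>\<close> by (simp_all add: h_def)
      qed
      moreover have "(- (b j + 3 * \<delta>) < - v \<and> - v < - (b j + 3 * \<delta>) + 3 * \<delta>)
          = (b j < v \<and> v < b j + 3 * \<delta>)" for v by auto
      ultimately show ?thesis using z(1) by (simp only:) blast
    qed
    then obtain z S where z: "z \<in> \<Omega>" and S: "finite S" "card S = h"
      and S_bin: "\<forall>t\<in>S. b j < f ((shift ^^ t) z) \<and> f ((shift ^^ t) z) < b j + 3 * \<delta>"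
      and neq: "\<forall>s\<in>S. \<forall>t\<in>S. s \<noteq> t \<longrightarrow> (\<exists>i<L. z (1 + int (s + i)) \<noteq> z (1 + int (t + i)))"
      by (elim exE conjE)
    define X where "X = (\<lambda>s. (shift ^^ s) z) ` S"
    have pw: "prefix_word N ((shift ^^ s) z) \<noteq> prefix_word N ((shift ^^ t) z)" if "s \<in> S" "t \<in> S" "s \<noteq> t" for s t
    proof
      assume "prefix_word N ((shift ^^ s) z) = prefix_word N ((shift ^^ t) z)"
      then have "prefix_word L ((shift ^^ s) z) = prefix_word L ((shift ^^ t) z)"
        by (rule prefix_word_mono) (rule LN)
      then have "\<forall>i<L. z (1 + int (s + i)) = z (1 + int (t + i))"
        by (simp add: prefix_word_eq_iff funpow_shift_apply algebra_simps)
      then show False using neq that by blast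
    qed
    have "inj_on (\<lambda>s. (shift ^^ s) z) S" by (rule inj_onI) (metis pw)
    then have "card X = h" using S by (simp add: X_def card_image)
    moreover have "inj_on (prefix_word N) X" using pw unfolding X_def inj_on_def by blast
    moreover have "X \<subseteq> {w \<in> \<Omega>. b j < f w \<and> f w < b j + 3 * \<delta>}"
      using S_bin funpow_shift_in[OF z] by (auto simp: X_def)
    moreover have "finite X" using S by (simp add: X_def)
    ultimately show ?thesis
      using card_words_le_measure[OF _ _ _ B_det, of X j] by (simp add: B_def)
  qed
  have "real r * (real h * c) = (\<Sum>j<r. real h * c)" by simp
  also have "\<dots> \<le> (\<Sum>j<r. measure \<mu> (B j))" by (intro sum_mono mass_B) auto
  also have "\<dots> = measure \<mu> (\<Union>j<r. B j)"
  proof (rule finite_measure_finite_Union[symmetric])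
    show "disjoint_family_on B {..<r}"
      unfolding disjoint_family_on_def
    proof (intro ballI impI)
      have disj: "B i \<inter> B j = {}" if "i < j" for i j
      proof -
        have "3 * \<delta> * real (Suc i) \<le> 3 * \<delta> * real j" using that \<open>0 < \<delta>\<close> by (intro mult_left_mono) auto
        then show ?thesis by (auto simp: B_def b_def algebra_simps)
      qed
      show "B i \<inter> B j = {}" if "i \<noteq> j" for i j
        using disj[of i j] disj[of j i] that by (auto simp: linorder_neq_iff)
    qed
  qed (use determined_sets[OF B_det] in \<open>auto simp: B_def\<close>)
  also have "\<dots> \<le> 1" by simp
  finally show False using assms(6) by (simp add: h_def)
qed

end

section \<open>Locally constant cocycles\<close>

text \<open>
The form in which the limit superior is used: a lower bound \<open>c0 / N\<close> at arbitrarily large lengths \<open>N\<close>.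
\<close>

lemma boshernitzan_frequent_mass:
  fixes \<Omega> :: "(int \<Rightarrow> 'a::{finite, discrete_topology}) set"
  assumes "boshernitzan \<Omega>"
  obtains \<mu> c0 where "invariant_prob \<Omega> \<mu>" "0 < c0"
    "\<And>M. \<exists>N\<ge>M. \<forall>w\<in>words \<Omega> N. c0 / real N \<le> measure \<mu> (cylinder \<Omega> w)"
proof -
  obtain \<mu> where \<mu>: "invariant_prob \<Omega> \<mu>" and
    ls: "limsup (\<lambda>n. ereal (real n * Min ((\<lambda>w. measure \<mu> (cylinder \<Omega> w)) ` words \<Omega> n))) > 0"
    using assms unfolding boshernitzan_def by blast
  obtain c0 where c0: "ereal 0 < ereal c0"
    "ereal c0 < limsup (\<lambda>n. ereal (real n * Min ((\<lambda>w. measure \<mu> (cylinder \<Omega> w)) ` words \<Omega> n)))"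
    using ereal_dense2[OF ls] by (auto simp: zero_ereal_def)
  have "\<exists>N\<ge>M. \<forall>w\<in>words \<Omega> N. c0 / real N \<le> measure \<mu> (cylinder \<Omega> w)" for M
  proof (rule ccontr)
    assume none: "\<not> ?thesis"
    have "real n * Min ((\<lambda>w. measure \<mu> (cylinder \<Omega> w)) ` words \<Omega> n) \<le> c0" if "M + 1 \<le> n" for n
    proof -
      obtain w where w: "w \<in> words \<Omega> n" "measure \<mu> (cylinder \<Omega> w) < c0 / real n"
        using none \<open>M + 1 \<le> n\<close> by (meson add_leE not_le)
      have "Min ((\<lambda>w. measure \<mu> (cylinder \<Omega> w)) ` words \<Omega> n) \<le> measure \<mu> (cylinder \<Omega> w)"
        using w(1) by (intro Min_le finite_imageI finite_words) auto
      also note w(2)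
      finally show ?thesis using that by (simp add: field_simps)
    qed
    then have "\<forall>\<^sub>F n in sequentially.
        ereal (real n * Min ((\<lambda>w. measure \<mu> (cylinder \<Omega> w)) ` words \<Omega> n)) \<le> ereal c0"
      unfolding eventually_sequentially by (intro exI[of _ "M + 1"]) simp
    then have "limsup (\<lambda>n. ereal (real n * Min ((\<lambda>w. measure \<mu> (cylinder \<Omega> w)) ` words \<Omega> n))) \<le> ereal c0"
      by (rule Limsup_bounded)
    with c0(2) show False by simp
  qed
  with \<mu> c0(1) show thesis by (intro that[of \<mu> c0]) auto
qed

lemma (in bounded_cocycle) determined_by_growth:
  assumes "determined_by \<Omega> w A"
  shows "determined_by \<Omega> (m + w) (growth A m)"
proof -
  have "cocycle_iter A k x = cocycle_iter A k y"
    if "k \<le> m" and xy: "x \<in> \<Omega>" "y \<in> \<Omega>" "prefix_word (m + w) x = prefix_word (m + w) y" for k x y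
    using that(1)
  proof (induction k)
    case (Suc k)
    have "prefix_word w ((shift ^^ k) x) = prefix_word w ((shift ^^ k) y)"
      using xy(3) by (rule prefix_word_funpow_shift) (use Suc.prems in simp)
    then have "A ((shift ^^ k) x) = A ((shift ^^ k) y)"
      by (intro determined_byD[OF assms] funpow_shift_in xy)
    with Suc show ?case by simp
  qed simp
  then show ?thesis unfolding determined_by_def growth_def by (metis order_refl)
qed

text \<open>
The constants fit together as follows. The rate is determined by \<open>L = m + w \<le> 2m\<close> letters, and \<open>small_drift\<close> needs
\<open>2L \<le> N\<close>. With steps of size \<open>\<sigma> = 2K/m\<close> there are \<open>q\<close>, about \<open>\<delta>m/(8K)\<close>, visited levels in a quarter of
\<open>\<delta>\<close>. As \<open>c\<close> is comparable to \<open>1/m\<close>, both \<open>q\<^sup>2 c \<delta>\<^sup>2\<close> and \<open>L \<eta>\<close> are of order \<open>m\<close>, and a small \<open>\<eta>\<close> that does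
not depend on \<open>m\<close> suffices. The number \<open>r\<close> of bands depends only on \<open>c0\<close>, because \<open>(L div 3) c \<ge> c0/96\<close>.
\<close>

lemma (in word_frequency) growth_oscillation:
  assumes "bounded_cocycle \<Omega> A K" and K: "1 \<le> K" and A: "determined_by \<Omega> w A"
    and "minimal_subshift \<Omega>"
    and c: "c = c0 / real N" and c0: "0 < c0" and r: "96 < real r * c0" and \<delta>: "0 < \<delta>"
    and m: "6 \<le> m" "w \<le> m" "8 * K \<le> \<delta> * real m" and N: "4 * m \<le> N" "N \<le> 16 * m"
    and almost_inv: "\<And>i. (\<integral>x. (growth A m ((shift ^^ i) x) / real m - growth A m x / real m)\<^sup>2 \<partial>\<mu>) \<le> \<eta>"
    and \<eta>: "\<eta> \<le> \<delta> ^ 4 * c0 / (100000 * K\<^sup>2)"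
    and xy: "x \<in> \<Omega>" "y \<in> \<Omega>"
  shows "growth A m y / real m - growth A m x / real m < 3 * \<delta> * real r"
proof -
  interpret A: bounded_cocycle \<Omega> A K by fact
  define L where "L = m + w"
  define f where "f x = growth A m x / real m" for x
  define q where "q = nat \<lfloor>\<delta> * real m / (8 * K)\<rfloor>"
  define \<sigma> where "\<sigma> = 2 * K / real m"
  have m0: "0 < real m" using m by simp
  have det: "determined_by \<Omega> L f"
    using A.determined_by_growth[OF A, of m] unfolding determined_by_def L_def f_def by metis
  have one: "1 \<le> \<delta> * real m / (8 * K)" using m(3) K by (simp add: field_simps)
  have q_up: "real q \<le> \<delta> * real m / (8 * K)" unfolding q_def using one by linarith
  have q_lo: "\<delta> * real m / (16 * K) \<le> real q" and q0: "0 < q"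
  proof -
    have "1 \<le> \<lfloor>\<delta> * real m / (8 * K)\<rfloor>" using one by (simp add: le_floor_iff)
    then have "1 \<le> real q" "\<delta> * real m / (8 * K) \<le> real q + 1" unfolding q_def by linarith+
    moreover have "\<delta> * real m / (16 * K) = (\<delta> * real m / (8 * K)) / 2" by simp
    ultimately show "\<delta> * real m / (16 * K) \<le> real q" "0 < q" by linarith+
  qed
  have c_lo: "c0 / (16 * real m) \<le> c"
    unfolding c using c0 N m0 by (intro divide_left_mono) (auto simp: mult_pos_pos)
  have slow: "\<bar>f (shift x) - f x\<bar> \<le> \<sigma>" if "x \<in> \<Omega>" for x
  proof -
    have "f (shift x) - f x = (growth A m (shift x) - growth A m x) / real m"
      by (simp add: f_def diff_divide_distrib)
    then show ?thesis
      using A.growth_shift_diff[OF that, of m] m0 by (simp add: \<sigma>_def divide_right_mono abs_divide)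
  qed
  have "real q * \<sigma> \<le> (\<delta> * real m / (8 * K)) * \<sigma>"
    using q_up K by (intro mult_right_mono) (auto simp: \<sigma>_def)
  also have "\<dots> = \<delta> / 4" using m0 K by (simp add: \<sigma>_def field_simps)
  finally have q\<sigma>: "real q * \<sigma> \<le> \<delta> / 4" .
  have small: "real (L + 1) * \<eta> < real q * c * (real q * (\<delta> / 2)\<^sup>2)"
  proof -
    define B where "B = \<delta> ^ 4 * c0 * real m / K\<^sup>2"
    have B0: "0 < B" using \<delta> c0 m0 K by (simp add: B_def)
    have "real (L + 1) * \<eta> \<le> real (L + 1) * (\<delta> ^ 4 * c0 / (100000 * K\<^sup>2))"
      using \<eta> by (intro mult_left_mono) auto
    also have "\<dots> \<le> (3 * real m) * (\<delta> ^ 4 * c0 / (100000 * K\<^sup>2))"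
      using m c0 by (intro mult_right_mono) (auto simp: L_def)
    also have "\<dots> = B * (3 / 100000)" by (simp add: B_def mult.commute mult.left_commute)
    also have "\<dots> < B * (1 / 16384)" using B0 by simp
    also have "\<dots> = (\<delta> * real m / (16 * K))\<^sup>2 * (c0 / (16 * real m)) * (\<delta> / 2)\<^sup>2"
      using m0 K by (simp add: B_def field_simps power2_eq_square power4_eq_xxxx)
    also have "\<dots> \<le> (real q)\<^sup>2 * c * (\<delta> / 2)\<^sup>2"
      using q_lo c_lo \<delta> c0 m0 K by (intro mult_right_mono mult_mono power_mono) auto
    also have "\<dots> = real q * c * (real q * (\<delta> / 2)\<^sup>2)" by (simp add: power2_eq_square)
    finally show ?thesis .
  qed
  have drift: "\<bar>f ((shift ^^ t) x) - f x\<bar> \<le> \<delta>" if "x \<in> \<Omega>" "t \<le> L" for x t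
  proof (rule small_drift[OF det _ slow _ q0 q\<sigma> _ small that])
    show "2 * L \<le> N" using m N by (simp add: L_def)
    show "0 < \<sigma>" using K m0 by (simp add: \<sigma>_def)
    show "(\<integral>x. (f ((shift ^^ i) x) - f x)\<^sup>2 \<partial>\<mu>) \<le> \<eta>" for i unfolding f_def by (rule almost_inv)
  qed
  have "f y - f x < 3 * \<delta> * real r"
  proof (rule small_oscillation[OF \<open>minimal_subshift \<Omega>\<close> det _ drift \<delta> _ xy])
    show "L \<le> N" using m N by (simp add: L_def)
    have "m \<le> 6 * (L div 3)" using m(1) by (simp add: L_def)
    then have h: "real m / 6 \<le> real (L div 3)" by linarith
    have "1 < real r * c0 / 96" using r by simp
    also have "\<dots> = real r * ((real m / 6) * (c0 / (16 * real m)))" using m0 by simp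
    also have "\<dots> \<le> real r * (real (L div 3) * c)"
      using h c_lo c0 m0 by (intro mult_left_mono mult_mono) auto
    finally show "1 < real r * (real (L div 3) * c)" .
  qed
  then show ?thesis by (simp add: f_def)
qed

text \<open>
Given a length \<open>N\<close> at which (B) is effective, choose \<open>m\<close> as the largest multiple of \<open>m1\<close> with \<open>8m \<le> N\<close>. Then both
\<open>m\<close> and \<open>2m\<close> are multiples of \<open>m1\<close> that are comparable to \<open>N\<close>, so both rates oscillate by at most \<open>e/4\<close>. The energies of
both scales lie in \<open>[D, D + \<eta>]\<close>, and therefore the rate at scale \<open>2m\<close> cannot be much smaller than the rate at scale \<open>m\<close>.
\<close>

theorem locally_constant_imp_rigid:
  fixes \<Omega> :: "(int \<Rightarrow> 'a::{finite, discrete_topology}) set"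
  assumes "boshernitzan \<Omega>" and "bounded_cocycle \<Omega> A K0" and A: "determined_by \<Omega> w A" and e: "0 < e"
  shows "\<exists>m. rigid_at \<Omega> A e m"
proof -
  define K where "K = max 1 K0"
  have K: "1 \<le> K" by (simp add: K_def)
  interpret A: bounded_cocycle \<Omega> A K
    using assms(2) by (force simp: bounded_cocycle_def K_def)
  have min: "minimal_subshift \<Omega>" using assms(1) by (simp add: boshernitzan_def)
  obtain \<mu> c0 where \<mu>: "invariant_prob \<Omega> \<mu>" and c0: "0 < c0"
    and mass: "\<And>M. \<exists>N\<ge>M. \<forall>w\<in>words \<Omega> N. c0 / real N \<le> measure \<mu> (cylinder \<Omega> w)"
    using boshernitzan_frequent_mass[OF assms(1)] by blast
  have prob: "prob_space \<mu>" using \<mu> by (simp add: invariant_prob_def)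
  have freq: "word_frequency \<mu> \<Omega> N c" if "\<forall>w\<in>words \<Omega> N. c \<le> measure \<mu> (cylinder \<Omega> w)" for N c
    using prob \<mu> A.shift_in that by (simp add: word_frequency_def word_frequency_axioms_def)
  \<comment> \<open>Measurability and invariance do not depend on the length of the words.\<close>
  interpret W: word_frequency \<mu> \<Omega> 0 0 by (rule freq) simp
  interpret S: subadditive_process \<mu> shift "growth A" K
  proof
    show "shift \<in> measurable \<mu> \<mu>" by (rule W.shift_measurable)
    show "distr \<mu> \<mu> shift = \<mu>" by (rule W.distr_shift)
    show "growth A n \<in> borel_measurable \<mu>" for n
      by (rule W.determined_measurable[OF A.determined_by_growth[OF A]])
  qed (simp_all add: A.growth_nonneg A.growth_le A.growth_add_le A.growth_funpow_shift_diff)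
  \<comment> \<open>The number of bands is fixed before their width \<open>3 * \<delta>\<close>, which is then chosen to give total width \<open>e / 4\<close>.\<close>
  define r where "r = nat \<lceil>96 / c0\<rceil> + 1"
  have "96 / c0 < real r" unfolding r_def by linarith
  then have r: "96 < real r * c0" using c0 by (simp add: field_simps)
  have r0: "0 < real r" by (simp add: r_def)
  define \<delta> where "\<delta> = e / (12 * real r)"
  have \<delta>: "0 < \<delta>" and \<delta>r: "3 * \<delta> * real r = e / 4" using e r0 by (simp_all add: \<delta>_def)
  define \<eta> where "\<eta> = min (\<delta> ^ 4 * c0 / (100000 * K\<^sup>2)) ((e / 2)\<^sup>2)"
  have \<eta>: "0 < \<eta>" "\<eta> \<le> \<delta> ^ 4 * c0 / (100000 * K\<^sup>2)" "\<eta> \<le> (e / 2)\<^sup>2"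
    using \<delta> c0 K e by (auto simp: \<eta>_def)
  obtain D m1 where m1: "1 \<le> m1"
    and D: "\<And>q. 1 \<le> q \<Longrightarrow> D \<le> S.energy (q * m1) \<and> S.energy (q * m1) \<le> D + \<eta>"
    and inv: "\<And>q i. 1 \<le> q \<Longrightarrow>
      (\<integral>x. (S.rate (q * m1) ((shift ^^ i) x) - S.rate (q * m1) x)\<^sup>2 \<partial>\<mu>) \<le> \<eta>"
    by (rule S.ex_almost_invariant_scale[OF \<eta>(1)]) auto
  define m0 where "m0 = 6 + w + nat \<lceil>8 * K / \<delta>\<rceil> + nat \<lceil>1 / e\<rceil>"
  obtain N where N: "8 * m1 + 16 * m0 \<le> N" and
    mass_N: "\<forall>w\<in>words \<Omega> N. c0 / real N \<le> measure \<mu> (cylinder \<Omega> w)" using mass by blast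
  interpret N: word_frequency \<mu> \<Omega> N "c0 / real N" by (rule freq) fact
  define q where "q = N div (8 * m1)"
  have q: "1 \<le> q" using N m1 by (simp add: q_def Suc_le_eq div_greater_zero_iff)
  define m where "m = q * m1"
  have m_eq: "8 * m = N div (8 * m1) * (8 * m1)" by (simp add: m_def q_def)
  from m_eq have Nm: "8 * m \<le> N" by (simp only: div_times_less_eq_dividend)
  have "8 * m + N mod (8 * m1) = N" unfolding m_eq by (rule div_mult_mod_eq)
  moreover have "N mod (8 * m1) < 8 * m1" using m1 by (intro mod_less_divisor) simp
  ultimately have "N < 8 * m + 8 * m1" by linarith
  moreover have "m1 \<le> m" using q by (simp add: m_def)
  ultimately have mN: "N \<le> 16 * m" by simp
  have m: "m0 \<le> m" using mN N by simp
  have osc: "S.rate (j * m) y - S.rate (j * m) x \<le> e / 4" if j: "j = 1 \<or> j = 2" and xy: "x \<in> \<Omega>" "y \<in> \<Omega>" for j x y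
  proof -
    have jm: "m \<le> j * m" "4 * (j * m) \<le> N" "N \<le> 16 * (j * m)" using j Nm mN by auto
    have "8 * K / \<delta> \<le> real (j * m)" using m jm(1) unfolding m0_def by linarith
    then have 8: "8 * K \<le> \<delta> * real (j * m)" using \<delta> by (simp add: field_simps)
    have 6: "6 \<le> j * m" "w \<le> j * m" using m jm(1) unfolding m0_def by linarith+
    have I: "(\<integral>x. (growth A (j * m) ((shift ^^ i) x) / real (j * m) - growth A (j * m) x / real (j * m))\<^sup>2 \<partial>\<mu>) \<le> \<eta>" for i
    proof -
      have "1 \<le> j * q" using j q by auto
      from inv[OF this, of i] show ?thesis by (simp only: S.rate_def m_def mult.assoc)
    qed
    from N.growth_oscillation[OF A.bounded_cocycle_axioms K A min refl c0 r \<delta> 6 8 jm(2,3) I \<eta>(2) xy]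
    show ?thesis by (simp only: S.rate_def \<delta>r less_imp_le)
  qed
  have mp: "0 < m" using m by (simp add: m0_def)
  have "1 / e \<le> real m" using m unfolding m0_def by linarith
  then have me: "1 \<le> real m * e" using e by (simp add: field_simps)
  obtain x0 where x0: "x0 \<in> \<Omega>" using W.not_empty by auto
  define l where "l = S.rate m x0"
  have up: "growth A m x \<le> real m * (l + e)" if "x \<in> \<Omega>" for x
  proof -
    have "S.rate m x \<le> l + e" using osc[of 1 x0 x] x0 that e by (simp add: l_def)
    then show ?thesis using mp by (simp add: S.rate_def field_simps)
  qed
  \<comment> \<open>Otherwise the rate at scale \<open>2m\<close> is everywhere below the rate at scale \<open>m\<close> by a gap that the energies exclude.\<close>
  have lo: "l - e \<le> S.rate (2 * m) x" if x: "x \<in> \<Omega>" for x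
  proof (rule ccontr)
    assume neg: "\<not> ?thesis"
    define a where "a = S.rate (2 * m) x + e / 4"
    have a0: "0 \<le> a" using S.rate_nonneg[of x "2 * m"] x e by (simp add: a_def)
    have la: "a + e / 2 < l - e / 4" using neg by (simp add: a_def)
    have ub: "S.rate (2 * m) y \<le> a" if "y \<in> \<Omega>" for y using osc[of 2 x y] x that by (simp add: a_def)
    have lb: "l - e / 4 \<le> S.rate m y" if "y \<in> \<Omega>" for y using osc[of 1 y x0] x0 that by (simp add: l_def)
    have int: "integrable \<mu> (\<lambda>y. (S.rate k y)\<^sup>2)" for k
      using S.rate_nonneg S.rate_le by (intro S.integrable_sq[where B = K]) auto
    have "(l - e / 4)\<^sup>2 = (\<integral>y. (l - e / 4)\<^sup>2 \<partial>\<mu>)" by (simp add: W.prob_space[simplified])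
    also have "\<dots> \<le> S.energy m"
      unfolding S.energy_def
    proof (rule integral_mono)
      show "(l - e / 4)\<^sup>2 \<le> (S.rate m y)\<^sup>2" if "y \<in> space \<mu>" for y
        using lb[of y] that la a0 e by (intro power_mono) auto
    qed (use int in auto)
    also have "\<dots> \<le> D + \<eta>" using D[OF q] by (simp add: m_def)
    also have "D \<le> S.energy (2 * m)"
    proof -
      have "1 \<le> 2 * q" using q by simp
      then show ?thesis using D[of "2 * q"] by (simp add: m_def mult.assoc)
    qed
    also have "S.energy (2 * m) \<le> (\<integral>y. a\<^sup>2 \<partial>\<mu>)"
      unfolding S.energy_def
    proof (rule integral_mono)
      show "(S.rate (2 * m) y)\<^sup>2 \<le> a\<^sup>2" if "y \<in> space \<mu>" for y
        using ub[of y] that S.rate_nonneg[of y "2 * m"] by (intro power_mono) auto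
    qed (use int in auto)
    also have "(\<integral>y. a\<^sup>2 \<partial>\<mu>) = a\<^sup>2" by (simp add: W.prob_space[simplified])
    finally have "(l - e / 4)\<^sup>2 \<le> a\<^sup>2 + (e / 2)\<^sup>2" using \<eta>(3) by simp
    also have "\<dots> \<le> (a + e / 2)\<^sup>2" using a0 e by (simp add: power2_sum)
    also have "\<dots> < (l - e / 4)\<^sup>2" using la a0 e by (intro power_strict_mono) auto
    finally show False by simp
  qed
  have "real (2 * m) * (l - e) \<le> growth A (2 * m) x" if "x \<in> \<Omega>" for x
    using lo[OF that] mp by (simp add: S.rate_def field_simps)
  with up me show ?thesis unfolding rigid_at_def by blast
qed

section \<open>The space of cocycles\<close>

lemma compact_subshift:
  fixes \<Omega> :: "(int \<Rightarrow> 'a::{finite, discrete_topology}) set"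
  assumes "subshift \<Omega>"
  shows "compact \<Omega>"
proof -
  have "compact_space (euclidean :: 'a topology)" by (simp add: compact_space_def finite_imp_compact)
  then have "compact_space (product_topology (\<lambda>i::int. euclidean :: 'a topology) UNIV)"
    by (simp add: compact_space_product_topology)
  then have "compact (UNIV :: (int \<Rightarrow> 'a) set)"
    unfolding euclidean_product_topology by (simp add: compact_space_def)
  moreover have "closed \<Omega>" using assms by (simp add: subshift_def)
  ultimately have "compact (UNIV \<inter> \<Omega>)" by (rule compact_Int_closed)
  then show ?thesis by simp
qed

lemma cocycles_iff:
  fixes \<Omega> :: "(int \<Rightarrow> 'a::{finite, discrete_topology}) set"
  assumes "compact \<Omega>"
  shows "A \<in> cocycles \<Omega> \<longleftrightarrow> A \<in> extensional \<Omega> \<and> (\<forall>\<omega>\<in>\<Omega>. det (A \<omega>) = 1) \<and> continuous_on \<Omega> A"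
proof -
  have "compactin (top_of_set \<Omega>) (topspace (top_of_set \<Omega>))"
    using assms by (simp add: compactin_subtopology)
  from compactin_mspace_cfunspace[OF this, of "submetric euclidean_metric SL2"]
  show ?thesis
    unfolding cocycles_def cocycle_metric_def
    by (auto simp: mtopology_of_submetric continuous_map_in_subtopology SL2_def)
qed

lemma cocycle_mdist_le_iff:
  assumes "A \<in> cocycles \<Omega>" "B \<in> cocycles \<Omega>" "\<Omega> \<noteq> {}"
  shows "mdist (cocycle_metric \<Omega>) A B \<le> r \<longleftrightarrow> (\<forall>\<omega>\<in>\<Omega>. dist (A \<omega>) (B \<omega>) \<le> r)"
  using cfunspace_mdist_le[of A "top_of_set \<Omega>" "submetric euclidean_metric SL2" B r] assms
  unfolding cocycles_def cocycle_metric_def by simp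

lemma cocycle_bounded:
  assumes "compact \<Omega>" "A \<in> cocycles \<Omega>" "\<And>\<omega>. \<omega> \<in> \<Omega> \<Longrightarrow> shift \<omega> \<in> \<Omega>"
  obtains K where "bounded_cocycle \<Omega> A K"
proof -
  have A: "\<forall>\<omega>\<in>\<Omega>. det (A \<omega>) = 1" "continuous_on \<Omega> A" using assms by (simp_all add: cocycles_iff)
  have "bounded (A ` \<Omega>)" by (intro compact_imp_bounded compact_continuous_image A assms)
  then obtain b where b: "\<And>\<omega>. \<omega> \<in> \<Omega> \<Longrightarrow> norm (A \<omega>) \<le> b" by (auto simp: bounded_iff)
  have "ln (opnorm (A \<omega>)) \<le> b" if "\<omega> \<in> \<Omega>" for \<omega>
  proof -
    have "1 \<le> opnorm (A \<omega>)" using A that by (simp add: opnorm_ge_1)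
    then have "ln (opnorm (A \<omega>)) \<le> opnorm (A \<omega>) - 1" by (intro ln_le_minus_one) simp
    then show ?thesis using opnorm_le_norm[of "A \<omega>"] b[OF that] by linarith
  qed
  then show thesis using A assms(3) by (intro that[of b] bounded_cocycle.intro) auto
qed

text \<open>
Products of finitely many factors depend continuously on the factors, and the logarithm has Lipschitz
constant one on \<open>[1, \<infinity>)\<close>, where the norms lie.
\<close>

lemma (in bounded_cocycle) growth_continuous:
  assumes "0 < e"
  shows "\<exists>d>0. \<forall>B. (\<forall>\<omega>\<in>\<Omega>. det (B \<omega>) = 1 \<and> dist (A \<omega>) (B \<omega>) \<le> d) \<longrightarrow>
           (\<forall>\<omega>\<in>\<Omega>. \<bar>growth B n \<omega> - growth A n \<omega>\<bar> \<le> e)"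
proof -
  have "\<exists>d>0. \<forall>B. (\<forall>\<omega>\<in>\<Omega>. det (B \<omega>) = 1 \<and> dist (A \<omega>) (B \<omega>) \<le> d) \<longrightarrow>
           (\<forall>\<omega>\<in>\<Omega>. opnorm (cocycle_iter B n \<omega> - cocycle_iter A n \<omega>) \<le> e)"
    using assms
  proof (induction n arbitrary: e)
    case 0
    have "opnorm 0 \<le> 0" by (rule opnorm_leI) simp
    then show ?case using 0 by (intro exI[of _ 1]) auto
  next
    case (Suc n)
    define Q where "Q = exp K + 1"
    define R where "R = exp (real n * K)"
    have QR: "1 < Q" "0 < R" by (simp_all add: Q_def R_def)
    have "0 < e / (2 * Q)" using Suc.prems QR by simp
    from Suc.IH[OF this] obtain d where d: "0 < d"
      "\<And>B \<omega>. (\<forall>\<omega>\<in>\<Omega>. det (B \<omega>) = 1 \<and> dist (A \<omega>) (B \<omega>) \<le> d) \<Longrightarrow> \<omega> \<in> \<Omega> \<Longrightarrow>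
        opnorm (cocycle_iter B n \<omega> - cocycle_iter A n \<omega>) \<le> e / (2 * Q)" by blast
    define d' where "d' = min d (min 1 (e / (2 * R)))"
    have d': "0 < d'" "d' \<le> d" "d' \<le> 1" "d' \<le> e / (2 * R)"
      using d Suc.prems QR by (simp_all add: d'_def)
    have "opnorm (cocycle_iter B (Suc n) \<omega> - cocycle_iter A (Suc n) \<omega>) \<le> e"
      if B: "\<forall>\<omega>\<in>\<Omega>. det (B \<omega>) = 1 \<and> dist (A \<omega>) (B \<omega>) \<le> d'" and w: "\<omega> \<in> \<Omega>" for B \<omega>
    proof -
      define \<omega>' where "\<omega>' = (shift ^^ n) \<omega>"
      have w': "\<omega>' \<in> \<Omega>" unfolding \<omega>'_def by (rule funpow_shift_in[OF w])
      have diff: "opnorm (B \<omega>' - A \<omega>') \<le> d'"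
        using opnorm_le_norm[of "B \<omega>' - A \<omega>'"] B w' by (auto simp: dist_norm norm_minus_commute)
      have "opnorm (A \<omega>') \<le> exp K"
        using ln_le_K[OF w'] opnorm_ge_1[OF det_1[OF w']] by (simp add: ln_le_cancel_iff[symmetric] del: ln_le_cancel_iff)
      then have BQ: "opnorm (B \<omega>') \<le> Q"
        using opnorm_diff_le[of "B \<omega>'" "A \<omega>'"] diff d'(3) by (simp add: Q_def)
      have AR: "opnorm (cocycle_iter A n \<omega>) \<le> R"
        using growth_le[OF w, of n] by (simp add: opnorm_iter_eq_exp[OF w] R_def)
      have IH: "opnorm (cocycle_iter B n \<omega> - cocycle_iter A n \<omega>) \<le> e / (2 * Q)"
        using B d'(2) by (intro d(2) w) fastforce
      have "opnorm (cocycle_iter B (Suc n) \<omega> - cocycle_iter A (Suc n) \<omega>)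
          \<le> opnorm (B \<omega>') * opnorm (cocycle_iter B n \<omega> - cocycle_iter A n \<omega>)
            + opnorm (B \<omega>' - A \<omega>') * opnorm (cocycle_iter A n \<omega>)"
      proof (rule opnorm_leI)
        fix x
        define D where "D = cocycle_iter B n \<omega> - cocycle_iter A n \<omega>"
        have "(cocycle_iter B (Suc n) \<omega> - cocycle_iter A (Suc n) \<omega>) *v x
          = (B \<omega>' ** D) *v x + ((B \<omega>' - A \<omega>') ** cocycle_iter A n \<omega>) *v x"
          by (simp add: D_def \<omega>'_def matrix_vector_mult_diff_rdistrib matrix_vector_mult_diff_distrib
              flip: matrix_vector_mul_assoc)
        also have "norm \<dots> \<le> opnorm (B \<omega>' ** D) * norm x + opnorm ((B \<omega>' - A \<omega>') ** cocycle_iter A n \<omega>) * norm x"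
          by (intro norm_triangle_le add_mono norm_mult_vec_le_opnorm)
        also have "\<dots> \<le> (opnorm (B \<omega>') * opnorm D) * norm x + (opnorm (B \<omega>' - A \<omega>') * opnorm (cocycle_iter A n \<omega>)) * norm x"
          by (intro add_mono mult_right_mono opnorm_mult_le norm_ge_zero)
        finally show "norm ((cocycle_iter B (Suc n) \<omega> - cocycle_iter A (Suc n) \<omega>) *v x)
          \<le> (opnorm (B \<omega>') * opnorm (cocycle_iter B n \<omega> - cocycle_iter A n \<omega>)
            + opnorm (B \<omega>' - A \<omega>') * opnorm (cocycle_iter A n \<omega>)) * norm x"
          by (simp only: D_def distrib_right)
      qed
      also have "\<dots> \<le> Q * (e / (2 * Q)) + (e / (2 * R)) * R"
        using BQ IH diff d'(4) AR QR Suc.prems opnorm_nonneg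
        by (intro add_mono mult_mono) auto
      also have "\<dots> = e" using QR by simp
      finally show ?thesis .
    qed
    then show ?case using d'(1) by blast
  qed
  then obtain d where d: "0 < d"
    "\<And>B \<omega>. (\<forall>\<omega>\<in>\<Omega>. det (B \<omega>) = 1 \<and> dist (A \<omega>) (B \<omega>) \<le> d) \<Longrightarrow> \<omega> \<in> \<Omega> \<Longrightarrow>
      opnorm (cocycle_iter B n \<omega> - cocycle_iter A n \<omega>) \<le> e" by blast
  have "\<bar>growth B n \<omega> - growth A n \<omega>\<bar> \<le> e"
    if B: "\<forall>\<omega>\<in>\<Omega>. det (B \<omega>) = 1 \<and> dist (A \<omega>) (B \<omega>) \<le> d" and w: "\<omega> \<in> \<Omega>" for B \<omega>
  proof -
    have ln_diff: "ln a - ln b \<le> \<bar>a - b\<bar>" if "1 \<le> a" "1 \<le> b" for a b :: real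
    proof (cases "b \<le> a")
      case True
      have "ln a - ln b = ln (a / b)" using that by (simp add: ln_div)
      also have "\<dots> \<le> a / b - 1" using that by (intro ln_le_minus_one) simp
      also have "\<dots> = (a - b) / b" using that by (simp add: field_simps)
      also have "\<dots> \<le> (a - b) / 1" using that True by (intro divide_left_mono) auto
      finally show ?thesis by simp
    next
      case False
      then have "ln a \<le> ln b" using that by simp
      then show ?thesis by (smt (verit) abs_ge_zero)
    qed
    have "det (cocycle_iter B k \<omega>) = 1" for k
      by (induction k) (use B funpow_shift_in[OF w] in \<open>auto simp: det_mul\<close>)
    then have 1: "1 \<le> opnorm (cocycle_iter B n \<omega>)" by (rule opnorm_ge_1)
    have 2: "\<bar>opnorm (cocycle_iter B n \<omega>) - opnorm (cocycle_iter A n \<omega>)\<bar> \<le> e"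
      using opnorm_diff_le d(2)[OF B w] by (rule order_trans)
    show ?thesis
      unfolding growth_def using ln_diff[OF 1 opnorm_iter_ge_1[OF w, of n]] ln_diff[OF opnorm_iter_ge_1[OF w, of n] 1] 2
      by linarith
  qed
  then show ?thesis using d(1) by blast
qed

lemma rigid_at_mono:
  assumes "rigid_at \<Omega> A e m" "e \<le> e'"
  shows "rigid_at \<Omega> A e' m"
proof -
  obtain l where me: "1 \<le> real m * e" and l: "\<And>\<omega>. \<omega> \<in> \<Omega> \<Longrightarrow> growth A m \<omega> \<le> real m * (l + e)"
    "\<And>\<omega>. \<omega> \<in> \<Omega> \<Longrightarrow> real (2 * m) * (l - e) \<le> growth A (2 * m) \<omega>"
    using assms(1) unfolding rigid_at_def by blast
  have "real m * e \<le> real m * e'" "real m * (l + e) \<le> real m * (l + e')"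
    "real (2 * m) * (l - e') \<le> real (2 * m) * (l - e)"
    using assms(2) by (auto intro!: mult_left_mono)
  then show ?thesis unfolding rigid_at_def using me l by (meson order_trans)
qed

text \<open>
The slack \<open>e' - e\<close> leaves room for a perturbation, because the inequalities of rigidity only involve two finite products.
\<close>

lemma (in bounded_cocycle) rigid_at_open:
  assumes "rigid_at \<Omega> A e m" "e < e'"
  shows "\<exists>d>0. \<forall>B. (\<forall>\<omega>\<in>\<Omega>. det (B \<omega>) = 1 \<and> dist (A \<omega>) (B \<omega>) \<le> d) \<longrightarrow> rigid_at \<Omega> B e' m"
proof -
  obtain l where me: "1 \<le> real m * e" and l: "\<And>\<omega>. \<omega> \<in> \<Omega> \<Longrightarrow> growth A m \<omega> \<le> real m * (l + e)"
    "\<And>\<omega>. \<omega> \<in> \<Omega> \<Longrightarrow> real (2 * m) * (l - e) \<le> growth A (2 * m) \<omega>"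
    using assms(1) unfolding rigid_at_def by blast
  define \<tau> where "\<tau> = e' - e"
  have \<tau>: "0 < \<tau>" using assms(2) by (simp add: \<tau>_def)
  have m1: "1 \<le> real m" using me by (cases m) auto
  obtain d1 where d1: "0 < d1" "\<And>B \<omega>. (\<forall>\<omega>\<in>\<Omega>. det (B \<omega>) = 1 \<and> dist (A \<omega>) (B \<omega>) \<le> d1) \<Longrightarrow> \<omega> \<in> \<Omega> \<Longrightarrow>
      \<bar>growth B m \<omega> - growth A m \<omega>\<bar> \<le> \<tau>" using growth_continuous[OF \<tau>] by blast
  obtain d2 where d2: "0 < d2" "\<And>B \<omega>. (\<forall>\<omega>\<in>\<Omega>. det (B \<omega>) = 1 \<and> dist (A \<omega>) (B \<omega>) \<le> d2) \<Longrightarrow> \<omega> \<in> \<Omega> \<Longrightarrow>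
      \<bar>growth B (2 * m) \<omega> - growth A (2 * m) \<omega>\<bar> \<le> \<tau>" using growth_continuous[OF \<tau>] by blast
  have "rigid_at \<Omega> B e' m" if B: "\<forall>\<omega>\<in>\<Omega>. det (B \<omega>) = 1 \<and> dist (A \<omega>) (B \<omega>) \<le> min d1 d2" for B
    unfolding rigid_at_def
  proof (intro conjI exI[of _ l] ballI)
    have "real m * e \<le> real m * e'" using assms(2) by (intro mult_left_mono) auto
    then show "1 \<le> real m * e'" using me by linarith
    fix \<omega> assume w: "\<omega> \<in> \<Omega>"
    have \<tau>m: "1 * \<tau> \<le> real m * \<tau>" using m1 \<tau> by (intro mult_right_mono) auto
    have "\<bar>growth B m \<omega> - growth A m \<omega>\<bar> \<le> \<tau>" using B by (intro d1(2) w) auto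
    then have "growth B m \<omega> \<le> real m * (l + e) + real m * \<tau>" using l(1)[OF w] \<tau>m by linarith
    then show "growth B m \<omega> \<le> real m * (l + e')" by (simp add: \<tau>_def algebra_simps)
    have "\<bar>growth B (2 * m) \<omega> - growth A (2 * m) \<omega>\<bar> \<le> \<tau>" using B by (intro d2(2) w) auto
    then have "real (2 * m) * (l - e) - 2 * (real m * \<tau>) \<le> growth B (2 * m) \<omega>"
      using l(2)[OF w] \<tau>m \<tau> by linarith
    then show "real (2 * m) * (l - e') \<le> growth B (2 * m) \<omega>" by (simp add: \<tau>_def algebra_simps)
  qed
  then show ?thesis using d1(1) d2(1) by (intro exI[of _ "min d1 d2"]) auto
qed

definition agree :: "nat \<Rightarrow> (int \<Rightarrow> 'a) \<Rightarrow> (int \<Rightarrow> 'a) \<Rightarrow> bool" where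
  "agree n x y \<longleftrightarrow> (\<forall>i. \<bar>i\<bar> \<le> int n \<longrightarrow> x i = y i)"

lemma open_agree: "open {y :: int \<Rightarrow> 'a::discrete_topology. agree n x y}"
proof -
  have eq: "{y. agree n x y} = (\<Inter>i\<in>{- int n..int n}. {y. y i = x i})"
    by (auto simp: agree_def abs_le_iff)
  show ?thesis unfolding eq by (rule open_INT) (use open_coordinate in blast)+
qed

text \<open>
Finitely many coordinates determine a basic open set of the product topology.
\<close>

lemma open_contains_agree:
  fixes U :: "(int \<Rightarrow> 'a::discrete_topology) set"
  assumes "open U" "x \<in> U"
  obtains n where "\<And>y. agree n x y \<Longrightarrow> y \<in> U"
proof -
  have "openin (product_topology (\<lambda>i::int. euclidean :: 'a topology) UNIV) U"
    unfolding euclidean_product_topology using assms(1) by simp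
  from product_topology_open_contains_basis[OF this assms(2)]
  obtain X where X: "x \<in> (\<Pi>\<^sub>E i\<in>UNIV. X i)" "finite {i. X i \<noteq> UNIV}" "(\<Pi>\<^sub>E i\<in>UNIV. X i) \<subseteq> U"
    by auto
  define n where "n = Max (insert 0 ((\<lambda>i. nat \<bar>i\<bar>) ` {i. X i \<noteq> UNIV}))"
  have n: "\<bar>i\<bar> \<le> int n" if "X i \<noteq> UNIV" for i
  proof -
    have "nat \<bar>i\<bar> \<le> n" unfolding n_def using X(2) that by (intro Max_ge) auto
    then show ?thesis by linarith
  qed
  have "y \<in> U" if "agree n x y" for y
  proof -
    have "y i \<in> X i" for i
    proof (cases "X i = UNIV")
      case False
      then have "x i = y i" using n[of i] that by (simp add: agree_def)
      moreover have "x i \<in> X i" using X(1) by auto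
      ultimately show ?thesis by simp
    qed simp
    then show ?thesis using X(3) by auto
  qed
  then show thesis by (rule that)
qed

text \<open>
A Lebesgue number argument, with finite windows in place of a metric on the space of sequences.
\<close>

lemma uniformly_determined:
  fixes \<Omega> :: "(int \<Rightarrow> 'a::discrete_topology) set" and A :: "(int \<Rightarrow> 'a) \<Rightarrow> 'b::metric_space"
  assumes "compact \<Omega>" "continuous_on \<Omega> A" "0 < e"
  obtains n where "\<And>x y. x \<in> \<Omega> \<Longrightarrow> y \<in> \<Omega> \<Longrightarrow> agree n x y \<Longrightarrow> dist (A x) (A y) < e"
proof -
  have "\<exists>n. \<forall>y\<in>\<Omega>. agree n x y \<longrightarrow> dist (A x) (A y) < e / 2" if x: "x \<in> \<Omega>" for x
  proof -
    have "\<exists>U. open U \<and> x \<in> U \<and> (\<forall>y\<in>\<Omega>. y \<in> U \<longrightarrow> A y \<in> ball (A x) (e / 2))"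
      using assms(2) x \<open>0 < e\<close> unfolding continuous_on_topological by (metis centre_in_ball half_gt_zero open_ball)
    then obtain U where U: "open U" "x \<in> U" "\<And>y. y \<in> \<Omega> \<Longrightarrow> y \<in> U \<Longrightarrow> dist (A x) (A y) < e / 2" by auto
    obtain n where "\<And>y. agree n x y \<Longrightarrow> y \<in> U" using open_contains_agree[OF U(1,2)] by blast
    then show ?thesis using U(3) by blast
  qed
  then obtain \<nu> where \<nu>: "\<And>x y. x \<in> \<Omega> \<Longrightarrow> y \<in> \<Omega> \<Longrightarrow> agree (\<nu> x) x y \<Longrightarrow> dist (A x) (A y) < e / 2"
    by metis
  have "\<Omega> \<subseteq> (\<Union>x\<in>\<Omega>. {y. agree (\<nu> x) x y})" by (auto simp: agree_def)
  then obtain C where C: "C \<subseteq> \<Omega>" "finite C" "\<Omega> \<subseteq> (\<Union>x\<in>C. {y. agree (\<nu> x) x y})"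
    using compactE_image[OF assms(1), of \<Omega> "\<lambda>x. {y. agree (\<nu> x) x y}"] open_agree by blast
  define n where "n = Max (insert 0 (\<nu> ` C))"
  show thesis
  proof (rule that[of n])
    fix x y assume xy: "x \<in> \<Omega>" "y \<in> \<Omega>" "agree n x y"
    obtain z where z: "z \<in> C" "agree (\<nu> z) z x" using C(3) xy(1) by blast
    have "\<nu> z \<le> n" unfolding n_def using C(2) z(1) by (intro Max_ge) auto
    then have "agree (\<nu> z) z y" using z(2) xy(3) unfolding agree_def by (metis dual_order.trans of_nat_mono)
    then have "dist (A z) (A x) < e / 2" "dist (A z) (A y) < e / 2"
      using \<nu> z C(1) xy by blast+
    then show "dist (A x) (A y) < e" by (metis dist_commute dist_triangle_half_l)
  qed
qed

text \<open>
Replace each value of \<open>A\<close> by its value at a chosen representative of the window \<open>[-n, n]\<close> around the origin. The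
new values are values of \<open>A\<close> and so stay in \<open>SL(2,\<real>)\<close>. A translation by \<open>n + 1\<close> moves the window to the
positions \<open>1, \<dots>, 2n + 1\<close> that prefix words see.
\<close>

lemma locally_constant_approximation:
  fixes \<Omega> :: "(int \<Rightarrow> 'a::{finite, discrete_topology}) set"
  assumes "compact \<Omega>" "\<And>\<omega>. \<omega> \<in> \<Omega> \<Longrightarrow> shift \<omega> \<in> \<Omega>" "A \<in> cocycles \<Omega>" "0 < e"
  obtains B w j where "B \<in> cocycles \<Omega>" "\<forall>\<omega>\<in>\<Omega>. dist (A \<omega>) (B \<omega>) \<le> e"
    "determined_by \<Omega> w (\<lambda>\<omega>. B ((shift ^^ j) \<omega>))"
proof -
  have A: "\<forall>\<omega>\<in>\<Omega>. det (A \<omega>) = 1" "continuous_on \<Omega> A" using assms by (simp_all add: cocycles_iff)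
  obtain n where n: "\<And>x y. x \<in> \<Omega> \<Longrightarrow> y \<in> \<Omega> \<Longrightarrow> agree n x y \<Longrightarrow> dist (A x) (A y) < e"
    using uniformly_determined[OF assms(1) A(2) assms(4)] by blast
  define rep where "rep x = (SOME y. y \<in> \<Omega> \<and> agree n x y)" for x
  have rep: "rep x \<in> \<Omega> \<and> agree n x (rep x)" if "x \<in> \<Omega>" for x
    unfolding rep_def using that by (intro someI[of "\<lambda>y. y \<in> \<Omega> \<and> agree n x y" x]) (simp add: agree_def)
  have rep_eq: "rep x = rep y" if "agree n x y" for x y
  proof -
    have "agree n x = agree n y" using that by (auto simp: agree_def fun_eq_iff)
    then show ?thesis by (simp add: rep_def)
  qed
  define B where "B = restrict (\<lambda>x. A (rep x)) \<Omega>"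
  have "continuous_on \<Omega> B"
    unfolding continuous_on_topological
  proof (intro ballI allI impI)
    fix x V assume x: "x \<in> \<Omega>" "open V" "B x \<in> V"
    have "\<forall>y\<in>\<Omega>. y \<in> {y. agree n x y} \<longrightarrow> B y \<in> V"
      using x rep_eq by (metis B_def mem_Collect_eq restrict_apply')
    then show "\<exists>U. open U \<and> x \<in> U \<and> (\<forall>y\<in>\<Omega>. y \<in> U \<longrightarrow> B y \<in> V)"
      using open_agree by (intro exI[of _ "{y. agree n x y}"]) (auto simp: agree_def)
  qed
  then have B: "B \<in> cocycles \<Omega>"
    using A rep assms(1) by (simp add: cocycles_iff B_def)
  show thesis
  proof (rule that[OF B])
    show "\<forall>\<omega>\<in>\<Omega>. dist (A \<omega>) (B \<omega>) \<le> e"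
    proof
      fix \<omega> assume \<omega>: "\<omega> \<in> \<Omega>"
      show "dist (A \<omega>) (B \<omega>) \<le> e" using n[OF \<omega>] rep[OF \<omega>] \<omega> by (simp add: B_def less_imp_le)
    qed
    have shift_n: "(shift ^^ k) x \<in> \<Omega>" if "x \<in> \<Omega>" for x k
      using assms(2) that by (rule funpow_shift_closed)
    show "determined_by \<Omega> (2 * n + 1) (\<lambda>\<omega>. B ((shift ^^ (n + 1)) \<omega>))"
      unfolding determined_by_def
    proof (intro ballI impI)
      fix x y assume xy: "x \<in> \<Omega>" "y \<in> \<Omega>" and eq: "prefix_word (2 * n + 1) x = prefix_word (2 * n + 1) y"
      have "agree n ((shift ^^ (n + 1)) x) ((shift ^^ (n + 1)) y)"
        unfolding agree_def funpow_shift_apply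
      proof (intro allI impI)
        fix i :: int assume "\<bar>i\<bar> \<le> int n"
        then have "nat (i + int n) < 2 * n + 1" "1 + int (nat (i + int n)) = i + int (n + 1)" by linarith+
        then show "x (i + int (n + 1)) = y (i + int (n + 1))"
          using eq unfolding prefix_word_eq_iff by metis
      qed
      from rep_eq[OF this] show "B ((shift ^^ (n + 1)) x) = B ((shift ^^ (n + 1)) y)"
        using shift_n[OF xy(1)] shift_n[OF xy(2)] by (simp only: B_def restrict_apply')
    qed
  qed
qed

text \<open>
Precomposition with a power of the shift does not change the set of values of the growth functions.
\<close>

lemma rigid_at_comp_shift:
  fixes \<Omega> :: "(int \<Rightarrow> 'a) set"
  assumes "shift ` \<Omega> = \<Omega>" "rigid_at \<Omega> (\<lambda>\<omega>. A ((shift ^^ j) \<omega>)) e m"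
  shows "rigid_at \<Omega> A e m"
proof -
  have comm: "(shift ^^ j) ((shift ^^ k) \<omega>) = (shift ^^ k) ((shift ^^ j) \<omega>)" for k and \<omega> :: "int \<Rightarrow> 'a"
    by (metis add.commute comp_apply funpow_add)
  have "cocycle_iter (\<lambda>\<omega>. A ((shift ^^ j) \<omega>)) k \<omega> = cocycle_iter A k ((shift ^^ j) \<omega>)" for k \<omega>
    by (induction k) (simp_all add: comm)
  then have growth: "growth (\<lambda>\<omega>. A ((shift ^^ j) \<omega>)) k \<omega> = growth A k ((shift ^^ j) \<omega>)" for k \<omega>
    by (simp add: growth_def)
  have surj: "(shift ^^ j) ` \<Omega> = \<Omega>" using assms(1) by (rule funpow_shift_image)
  obtain l where me: "1 \<le> real m * e" and l: "\<And>\<omega>. \<omega> \<in> \<Omega> \<Longrightarrow>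
      growth A m ((shift ^^ j) \<omega>) \<le> real m * (l + e) \<and> real (2 * m) * (l - e) \<le> growth A (2 * m) ((shift ^^ j) \<omega>)"
    using assms(2) unfolding rigid_at_def growth by blast
  have "growth A m \<omega> \<le> real m * (l + e) \<and> real (2 * m) * (l - e) \<le> growth A (2 * m) \<omega>" if "\<omega> \<in> \<Omega>" for \<omega>
  proof -
    have "\<omega> \<in> (shift ^^ j) ` \<Omega>" using that by (simp only: surj)
    then obtain \<omega>' where "\<omega>' \<in> \<Omega>" "\<omega> = (shift ^^ j) \<omega>'" by blast
    then show ?thesis using l[of \<omega>'] by (simp only:)
  qed
  with me show ?thesis unfolding rigid_at_def by blast
qed

section \<open>Genericity of uniform cocycles\<close>

theorem corollary1p9:
  fixes \<Omega> :: "(int \<Rightarrow> 'a::{finite, discrete_topology}) set"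
  assumes "subshift \<Omega>" and "aperiodic \<Omega>" and "boshernitzan \<Omega>"
  shows "gdelta_in (cocycle_topology \<Omega>) {A \<in> cocycles \<Omega>. uniform_cocycle \<Omega> A} \<and>
         cocycle_topology \<Omega> closure_of {A \<in> cocycles \<Omega>. uniform_cocycle \<Omega> A} = cocycles \<Omega>"
proof -
  interpret C: Metric_space "cocycles \<Omega>" "mdist (cocycle_metric \<Omega>)"
    unfolding cocycles_def by (rule Metric_space_mspace_mdist)
  have top: "cocycle_topology \<Omega> = C.mtopology"
    by (simp add: cocycle_topology_def mtopology_of_def cocycles_def)
  have comp: "compact \<Omega>" using assms(1) by (rule compact_subshift)
  have shift_\<Omega>: "shift ` \<Omega> = \<Omega>" using assms(1) by (simp add: subshift_def)
  then have shift_in: "shift \<omega> \<in> \<Omega>" if "\<omega> \<in> \<Omega>" for \<omega> using that by blast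
  obtain \<mu> where "invariant_prob \<Omega> \<mu>" using assms(3) unfolding boshernitzan_def by blast
  then interpret W: word_frequency \<mu> \<Omega> 0 0
    using shift_in by (simp add: word_frequency_def word_frequency_axioms_def invariant_prob_def)
  have ne: "\<Omega> \<noteq> {}" using W.not_empty by simp
  have bounded: "\<exists>K. bounded_cocycle \<Omega> A K" if "A \<in> cocycles \<Omega>" for A
    using cocycle_bounded[OF comp that shift_in] by blast
  have dist_le: "mdist (cocycle_metric \<Omega>) A B \<le> r \<longleftrightarrow> (\<forall>\<omega>\<in>\<Omega>. dist (A \<omega>) (B \<omega>) \<le> r)"
    if "A \<in> cocycles \<Omega>" "B \<in> cocycles \<Omega>" for A B r
    using cocycle_mdist_le_iff[OF that ne] .
  \<comment> \<open>The strict inequality leaves the slack that makes these sets open.\<close>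
  define V where "V j = {A \<in> cocycles \<Omega>. \<exists>m e. e < inverse (real (Suc j)) \<and> rigid_at \<Omega> A e m}" for j
  have uniform_iff: "uniform_cocycle \<Omega> A \<longleftrightarrow> (\<forall>e>0. \<exists>m. rigid_at \<Omega> A e m)" if "A \<in> cocycles \<Omega>" for A
    using bounded[OF that] bounded_cocycle.uniform_cocycle_iff_rigid ne by blast
  have eq: "{A \<in> cocycles \<Omega>. uniform_cocycle \<Omega> A} = (\<Inter>j. V j)"
  proof (intro subset_antisym subsetI)
    fix A assume A: "A \<in> {A \<in> cocycles \<Omega>. uniform_cocycle \<Omega> A}"
    have "\<exists>m e. e < inverse (real (Suc j)) \<and> rigid_at \<Omega> A e m" for j
    proof -
      have "0 < inverse (real (Suc j)) / 2" by simp
      then obtain m where "rigid_at \<Omega> A (inverse (real (Suc j)) / 2) m" using A uniform_iff by blast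
      moreover have "inverse (real (Suc j)) / 2 < inverse (real (Suc j))" by simp
      ultimately show ?thesis by blast
    qed
    then show "A \<in> (\<Inter>j. V j)" using A by (auto simp: V_def)
  next
    fix A assume A: "A \<in> (\<Inter>j. V j)"
    then have Ac: "A \<in> cocycles \<Omega>" by (auto simp: V_def)
    have "\<exists>m. rigid_at \<Omega> A e m" if "0 < e" for e
    proof -
      obtain j where j: "inverse (real (Suc j)) < e" using reals_Archimedean[OF \<open>0 < e\<close>] by blast
      have "A \<in> V j" using A by blast
      then obtain m e' where "e' < inverse (real (Suc j))" "rigid_at \<Omega> A e' m" unfolding V_def by blast
      then show ?thesis using rigid_at_mono[of \<Omega> A e' m e] j by auto
    qed
    then show "A \<in> {A \<in> cocycles \<Omega>. uniform_cocycle \<Omega> A}" using Ac uniform_iff by blast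
  qed
  have V_open: "openin C.mtopology (V j)" for j
    unfolding C.openin_mtopology
  proof (intro conjI allI impI)
    show "V j \<subseteq> cocycles \<Omega>" by (auto simp: V_def)
    fix A assume "A \<in> V j"
    then obtain m e where A: "A \<in> cocycles \<Omega>" and e: "e < inverse (real (Suc j))" and R: "rigid_at \<Omega> A e m"
      unfolding V_def by blast
    obtain e' where e': "e < e'" "e' < inverse (real (Suc j))" using dense[OF e] by blast
    obtain K where "bounded_cocycle \<Omega> A K" using bounded[OF A] by blast
    from bounded_cocycle.rigid_at_open[OF this R e'(1)] obtain d where d: "0 < d"
      "\<And>B. (\<forall>\<omega>\<in>\<Omega>. det (B \<omega>) = 1 \<and> dist (A \<omega>) (B \<omega>) \<le> d) \<Longrightarrow> rigid_at \<Omega> B e' m" by blast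
    have "C.mball A d \<subseteq> V j"
    proof
      fix B assume B: "B \<in> C.mball A d"
      then have Bc: "B \<in> cocycles \<Omega>" and "mdist (cocycle_metric \<Omega>) A B \<le> d" by (auto simp: C.mball_def)
      then have "\<forall>\<omega>\<in>\<Omega>. det (B \<omega>) = 1 \<and> dist (A \<omega>) (B \<omega>) \<le> d"
        using dist_le[OF A Bc] cocycles_iff[OF comp] by blast
      from d(2)[OF this] show "B \<in> V j" using Bc e'(2) by (auto simp: V_def)
    qed
    with d(1) show "\<exists>r>0. C.mball A r \<subseteq> V j" by blast
  qed
  have gdelta: "gdelta_in C.mtopology (\<Inter>j. V j)"
    using open_imp_gdelta_in[OF V_open] by (intro gdelta_in_Inter) auto
  have dense: "C.mtopology closure_of {A \<in> cocycles \<Omega>. uniform_cocycle \<Omega> A} = cocycles \<Omega>"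
    unfolding C.metric_closure_of
  proof (intro subset_antisym subsetI CollectI conjI allI impI)
    fix A and r :: real assume A: "A \<in> cocycles \<Omega>" and r: "0 < r"
    obtain B w j where B: "B \<in> cocycles \<Omega>" "\<forall>\<omega>\<in>\<Omega>. dist (A \<omega>) (B \<omega>) \<le> r / 2"
      and det: "determined_by \<Omega> w (\<lambda>\<omega>. B ((shift ^^ j) \<omega>))"
      by (rule locally_constant_approximation[OF comp shift_in A half_gt_zero[OF r]])
    obtain K where "bounded_cocycle \<Omega> B K" using bounded[OF B(1)] by blast
    then have shifted: "bounded_cocycle \<Omega> (\<lambda>\<omega>. B ((shift ^^ j) \<omega>)) K"
      by (simp add: bounded_cocycle_def W.funpow_shift_in)
    have "\<exists>m. rigid_at \<Omega> B e m" if "0 < e" for e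
      using locally_constant_imp_rigid[OF assms(3) shifted det that] rigid_at_comp_shift[OF shift_\<Omega>] by blast
    then have "uniform_cocycle \<Omega> B" using uniform_iff[OF B(1)] by blast
    moreover have "mdist (cocycle_metric \<Omega>) A B \<le> r / 2" using dist_le[OF A B(1)] B(2) by blast
    then have "B \<in> C.mball A r" using A B(1) r by simp
    ultimately show "\<exists>y\<in>{A \<in> cocycles \<Omega>. uniform_cocycle \<Omega> A}. y \<in> C.mball A r" using B(1) by blast
  qed auto
  show ?thesis unfolding top using gdelta dense by (simp only: eq)
qed

end
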